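(* Let $w\in S_n$, let $D_1,D_2\in\mathrm{RPD}(w)$ be reduced pipe dreams for $w$, and let $S$ be the set of southwest extremal coordinates where $D_1$ and $D_2$ differ, i.e. the set of $(i,j)$ such that $D_1(i,j)\ne D_2(i,j)$ and $D_1(i',j')=D_2(i',j')$ for every $(i',j')\neq(i,j)$ with $i'\ge i$ and $j'\le j$. Then $D_1\le D_2$ if and only if both of the following hold: (1) $D_1(i,j)=+$ for every $(i,j)\in S$; and (2) the pipe dream $D'$ obtained from $D_1$ by applying the move operators $\mathcal{M}_{ij}$, $(i,j)\in S$, one after the other (the order is irrelevant since these operators commute, the elements of $S$ being pairwise southwest incomparable) satisfies $D'\le D_2$. (Condition (2) is understood to include that these moves are defined.)
   Context: A pipe dream is a finite subset $D\subset \mathbb{Z}_{>0}\times\mathbb{Z}_{>0}$, in matrix coordinates ($(i,j)$ is row $i$ from the top, column $j$ from the left). Place a cross tile at each $(i,j)\in D$ (one strand joins the left and right edges, the other joins the top and bottom edges) and a bump tile at each $(i,j)\notin D$ (one strand joins the top edge to the left edge, the other joins the right edge to the bottom edge). Write $D(i,j)=+$ if $(i,j)\in D$ and $D(i,j)=\bullet$ otherwise. The strands form pipes going from the top boundary to the left boundary; pipe $x$ is the one entering at the top of column $x$. The permutation $w$ of $D$ is defined by: $w(i)$ is the label of the pipe that exits the left boundary in row $i$. Permutations $w\in S_n$ are regarded as permutations of $\mathbb{Z}_{>0}$ fixing all $m>n$. $\mathrm{RPD}(w)$ is the set of reduced pipe dreams for $w$: pipe dreams $D$ whose permutation is $w$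 and such that $|D|$ equals the number of inversions of $w$. Generalized ladder move: let $D\in\mathrm{RPD}(w)$, and suppose there are $h<i$ and $j<k$ such that $D(i,j)=+$, $D(h,j)=D(i,k)=D(h,k)=\bullet$, and every other tile in $[h,i]\times[j,k]$ is a $+$. Then $(i,j)$ is called ladder movable in $D$, and $\mathcal{L}_{ij}(D)\in\mathrm{RPD}(w)$ is obtained from $D$ by swapping the tiles at $(i,j)$ and $(h,k)$ (given $(i,j)$, the pair $(h,k)$ is unique). Order: $D\le D'$ in $\mathrm{RPD}(w)$ iff $D'$ can be obtained from $D$ by a (possibly empty) sequence of generalized ladder moves. Move operators: a cross tile $(i,j)$ of $D$ is movable in $D$ if $D(h,j)=\bullet$ for some $h\in[1,i-1]$. Then put $h_{ij}(D)=\max\{h\in[1,i-1]: D(h,j)=\bullet\}$, $k_{ij}(D)=\min\{k\in[j+1,n]: D(i,k)=\bullet\}$ (which exists), $\mathrm{Rect}_{ij}(D)=[h,i]\times[j,k]$ with $h=h_{ij}(D)$, $k=k_{ij}(D)$, let $a$ be the largest $p\in[h,i)$ such that row $p$ contains a $\bullet$ in $\mathrm{Rect}_{ij}(D)$, and let $b$ be the smallest $q\in(j,k]$ such that column $q$ contains a $\bullet$ in $\mathrm{Rect}_{ij}(D)$. Define $\mathcal{M}_{ij}(D)$ recursively for $(i,j)$ movable in $D$: (i) if $a=h$ and $b=k$, then $(i,j)$ is ladder movable and $\mathcal{M}_{ij}(D)=\mathcal{L}_{ij}(D)$; (ii) if $a>h$, $\mathcal{M}_{ij}(D)=\mathcal{M}_{ij}(\mathcal{M}_{aj}(D))$;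 (iii) otherwise, $\mathcal{M}_{ij}(D)=\mathcal{M}_{ij}(\mathcal{M}_{ib}(D))$. This recursion is well defined and terminates. *)

theory Defs
  imports Main "HOL-Combinatorics.Permutations"
begin

text \<open>
  A tile \<open>(i, j)\<close> is in row \<open>i\<close> (from the top) and column \<open>j\<close> (from the left), both starting at 1.
  A pipe dream is identified with its set of cross tiles.
\<close>

type_synonym tile = "nat \<times> nat"

definition pipe_dream :: "tile set \<Rightarrow> bool" where
  "pipe_dream D \<longleftrightarrow> finite D \<and> D \<subseteq> {1..} \<times> {1..}"


text \<open>
  \<open>from_top D x i j\<close>: pipe \<open>x\<close> enters tile \<open>(i, j)\<close> through its top edge;
  \<open>from_right D x i j\<close>: pipe \<open>x\<close> enters tile \<open>(i, j)\<close> through its right edge.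
  The right edge of the (non-existent) tile \<open>(i, 0)\<close> is the left boundary in row \<open>i\<close>,
  so \<open>from_right D x i 0\<close> means that pipe \<open>x\<close> exits in row \<open>i\<close>.
\<close>

inductive from_top :: "tile set \<Rightarrow> nat \<Rightarrow> nat \<Rightarrow> nat \<Rightarrow> bool"
  and from_right :: "tile set \<Rightarrow> nat \<Rightarrow> nat \<Rightarrow> nat \<Rightarrow> bool"
  for D :: "tile set" and x :: nat where
  start: "x \<ge> 1 \<Longrightarrow> from_top D x 1 x"
| cross_top_bottom: "from_top D x i (Suc j) \<Longrightarrow> (i, Suc j) \<in> D \<Longrightarrow> from_top D x (Suc i) (Suc j)"
| bump_top_left: "from_top D x i (Suc j) \<Longrightarrow> (i, Suc j) \<notin> D \<Longrightarrow> from_right D x i j"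
| cross_right_left: "from_right D x i (Suc j) \<Longrightarrow> (i, Suc j) \<in> D \<Longrightarrow> from_right D x i j"
| bump_right_bottom: "from_right D x i (Suc j) \<Longrightarrow> (i, Suc j) \<notin> D \<Longrightarrow> from_top D x (Suc i) (Suc j)"

definition exits_in_row :: "tile set \<Rightarrow> nat \<Rightarrow> nat \<Rightarrow> bool" where
  "exits_in_row D x i \<longleftrightarrow> from_right D x i 0"

definition has_permutation :: "tile set \<Rightarrow> (nat \<Rightarrow> nat) \<Rightarrow> bool" where
  "has_permutation D w \<longleftrightarrow> (\<forall>i\<ge>1. \<forall>x. exits_in_row D x i \<longleftrightarrow> x = w i)"

definition inversions :: "(nat \<Rightarrow> nat) \<Rightarrow> (nat \<times> nat) set" where
  "inversions w = {(i, j). 1 \<le> i \<and> i < j \<and> w i > w j}"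

definition RPD :: "(nat \<Rightarrow> nat) \<Rightarrow> tile set set" where
  "RPD w = {D. pipe_dream D \<and> has_permutation D w \<and> card D = card (inversions w)}"


text \<open>\<open>ladder_rect D i j h k\<close>: tile \<open>(i, j)\<close> is ladder movable in \<open>D\<close>, with opposite corner \<open>(h, k)\<close>.\<close>

definition ladder_rect :: "tile set \<Rightarrow> nat \<Rightarrow> nat \<Rightarrow> nat \<Rightarrow> nat \<Rightarrow> bool" where
  "ladder_rect D i j h k \<longleftrightarrow>
     1 \<le> h \<and> h < i \<and> 1 \<le> j \<and> j < k \<and>
     (i, j) \<in> D \<and> (h, j) \<notin> D \<and> (i, k) \<notin> D \<and> (h, k) \<notin> D \<and>
     {h..i} \<times> {j..k} - {(h, j), (i, k), (h, k)} \<subseteq> D"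

definition ladder_move :: "nat \<Rightarrow> nat \<Rightarrow> tile set \<Rightarrow> tile set \<Rightarrow> bool" where
  "ladder_move i j D D' \<longleftrightarrow>
     (\<exists>h k. ladder_rect D i j h k \<and> D' = insert (h, k) (D - {(i, j)}))"

definition pd_le :: "(nat \<Rightarrow> nat) \<Rightarrow> tile set \<Rightarrow> tile set \<Rightarrow> bool" where
  "pd_le w D D' \<longleftrightarrow>
     D \<in> RPD w \<and> D' \<in> RPD w \<and> (\<lambda>E E'. \<exists>i j. ladder_move i j E E')\<^sup>*\<^sup>* D D'"


definition movable :: "tile set \<Rightarrow> nat \<Rightarrow> nat \<Rightarrow> bool" where
  "movable D i j \<longleftrightarrow> (i, j) \<in> D \<and> (\<exists>h\<in>{1..<i}. (h, j) \<notin> D)"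

definition rect_top :: "tile set \<Rightarrow> nat \<Rightarrow> nat \<Rightarrow> nat" where
  "rect_top D i j = Max {h \<in> {1..<i}. (h, j) \<notin> D}"

text \<open>
  The set in \<open>rect_right\<close> is non-empty for a movable tile of a reduced pipe dream of a
  permutation of \<open>{1..n}\<close>, since all crosses \<open>(i, j)\<close> of such a pipe dream satisfy \<open>i + j \<le> n\<close>.
\<close>

definition rect_right :: "nat \<Rightarrow> tile set \<Rightarrow> nat \<Rightarrow> nat \<Rightarrow> nat" where
  "rect_right n D i j = Min {k \<in> {j + 1..n}. (i, k) \<notin> D}"

definition bump_row :: "nat \<Rightarrow> tile set \<Rightarrow> nat \<Rightarrow> nat \<Rightarrow> nat" where
  "bump_row n D i j =
     Max {p \<in> {rect_top D i j..<i}. \<exists>q\<in>{j..rect_right n D i j}. (p, q) \<notin> D}"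

definition bump_col :: "nat \<Rightarrow> tile set \<Rightarrow> nat \<Rightarrow> nat \<Rightarrow> nat" where
  "bump_col n D i j =
     Min {q \<in> {j<..rect_right n D i j}. \<exists>p\<in>{rect_top D i j..i}. (p, q) \<notin> D}"

text \<open>
  The graph of the recursively defined partial operator: \<open>move_op n i j D D'\<close> says that the move
  operator at \<open>(i, j)\<close> is defined on \<open>D\<close> with value \<open>D'\<close>. The conditions of the three rules are
  mutually exclusive and each rule determines the value, so the graph is functional. In rule
  \<open>ladder\<close>, for \<open>D\<close> as in the comment on \<open>rect_right\<close>, the premise \<open>ladder_move\<close> can only hold for the
  rectangle with corners \<open>(i, j)\<close> and \<open>(rect_top D i j, rect_right n D i j)\<close>.
\<close>

inductive move_op :: "nat \<Rightarrow> nat \<Rightarrow> nat \<Rightarrow> tile set \<Rightarrow> tile set \<Rightarrow> bool" for n :: nat where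
  ladder: "\<lbrakk>movable D i j; bump_row n D i j = rect_top D i j; bump_col n D i j = rect_right n D i j;
            ladder_move i j D D'\<rbrakk> \<Longrightarrow> move_op n i j D D'"
| up: "\<lbrakk>movable D i j; bump_row n D i j > rect_top D i j;
        move_op n (bump_row n D i j) j D E; move_op n i j E D'\<rbrakk> \<Longrightarrow> move_op n i j D D'"
| right: "\<lbrakk>movable D i j; bump_row n D i j = rect_top D i j; bump_col n D i j < rect_right n D i j;
           move_op n i (bump_col n D i j) D E; move_op n i j E D'\<rbrakk> \<Longrightarrow> move_op n i j D D'"

text \<open>Applying the move operators at the tiles of a list, from the head of the list onwards.\<close>

inductive move_ops :: "nat \<Rightarrow> tile list \<Rightarrow> tile set \<Rightarrow> tile set \<Rightarrow> bool" for n :: nat where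
  Nil: "move_ops n [] D D"
| Cons: "move_op n i j D E \<Longrightarrow> move_ops n xs E D' \<Longrightarrow> move_ops n ((i, j) # xs) D D'"

definition sw_extremal_diff :: "tile set \<Rightarrow> tile set \<Rightarrow> tile set" where
  "sw_extremal_diff D1 D2 =
     {(i, j). 1 \<le> i \<and> 1 \<le> j \<and> ((i, j) \<in> D1) \<noteq> ((i, j) \<in> D2) \<and>
        (\<forall>i' j'. i' \<ge> i \<and> 1 \<le> j' \<and> j' \<le> j \<and> (i', j') \<noteq> (i, j) \<longrightarrow>
           ((i', j') \<in> D1) = ((i', j') \<in> D2))}"

end

theory Submission
  imports Defs
begin

text \<open>
  A ladder move takes a cross to the north-east. So on a south-west closed set of tiles the sum of
  the row numbers of the crosses never increases, and it drops when a cross of the set moves: if two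
  comparable pipe dreams agree on such a set, no chain between them touches it. This gives
  condition (1).

  Condition (2) rests on the fact that the move operator at \<open>(i, j)\<close> yields the least pipe dream
  above \<open>D\<close> without cross at \<open>(i, j)\<close> and with the same tiles strictly south-west of \<open>(i, j)\<close>. Let
  \<open>D2\<close> be another such pipe dream and \<open>D \<rightarrow> E\<close> the first ladder move of a chain to \<open>D2\<close>.
  Inductively the operator takes \<open>E\<close> to a pipe dream below \<open>D2\<close>, so it is enough to compare its
  values at \<open>D\<close> and \<open>E\<close>, by a case distinction on the recursion at \<open>D\<close> and on the position of the ladder move relative to
  the rectangle of \<open>(i, j)\<close>. That \<open>D\<close> is reduced is used twice: two pipes do not cross twice,
  so the fourth corner of an otherwise full rectangle is a bump, and all crosses \<open>(i, j)\<close> satisfy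
  \<open>i + j \<le> n\<close>.
\<close>

section \<open>Pipes and local changes of a pipe dream\<close>

text \<open>Let the recursion at \<open>D\<close> begin with an inner tile, \<open>(a, j)\<close> or
  \<open>(i, b)\<close>. Once the value at this tile is known to lie below the value
  \<open>E'\<close> at \<open>E\<close>, induction finishes the comparison, since an operator lowers
  the row sum. The natural route is to let the recursion at \<open>E\<close> begin with the same
  inner tile and to use optimality of that tile at \<open>D\<close>. Two obstacles arise. The ladder
  move may alter the rectangle: vacate a tile of its border, open a bump inside it or fill one.
  Mostly the recursion at \<open>E\<close> still reaches the inner tile before anything else. Or the
  ladder move may start strictly south-west of the inner tile though not of \<open>(i, j)\<close>,
  so that optimality of the inner tile does not apply. If its rectangle misses the north-east
  quadrant of the inner tile, the ladder move and the inner operator commute. In the few remaining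
  positions the final values are compared directly, which is possible because they have a closed
  form (\<open>shift\<close>) or arise from each other by transplanting a row
  (\<open>mirror\<close>).\<close>

lemma pipe_edge_pos:
  shows "from_top D x r c \<Longrightarrow> 1 \<le> r \<and> 1 \<le> c"
    and "from_right D x r c \<Longrightarrow> 1 \<le> r"
  by (induction rule: from_top_from_right.inducts) auto

text \<open>The tile determines from which edge a pipe arrived, so pipes can be traced backwards.
  Hence a permutation is verified by exhibiting one exiting pipe per row.\<close>

lemma pipe_edge_unique:
  shows "from_top D x r c \<Longrightarrow> from_top D y r c \<Longrightarrow> y = x"
    and "from_right D x r c \<Longrightarrow> from_right D y r c \<Longrightarrow> y = x"
proof -
  have "from_top D x r c \<Longrightarrow> (\<forall>y. from_top D y r c \<longrightarrow> y = x)"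
    and "from_right D x r c \<Longrightarrow> (\<forall>y. from_right D y r c \<longrightarrow> y = x)"
  proof (induction rule: from_top_from_right.inducts)
    case start
    show ?case
    proof (intro allI impI)
      fix y assume "from_top D y 1 x"
      then show "y = x"
        by (cases rule: from_top.cases)
          (use pipe_edge_pos(1)[of D y 0 x] pipe_edge_pos(2)[of D y 0 x] in \<open>simp_all\<close>)
    qed
  next
    case prev: (cross_top_bottom i j)
    show ?case
    proof (intro allI impI)
      fix y assume "from_top D y (Suc i) (Suc j)"
      then show "y = x"
        by (cases rule: from_top.cases)
          (use prev(1,3) in \<open>auto dest: pipe_edge_pos\<close>, use prev(2) in \<open>blast\<close>)
    qed
  next
    case prev: (bump_top_left i j)
    show ?case
    proof (intro allI impI)
      fix y assume "from_right D y i j"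
      then show "y = x"
        by (cases rule: from_right.cases) (use prev(3) in \<open>auto\<close>, use prev(2) in \<open>blast\<close>)
    qed
  next
    case prev: (cross_right_left i j)
    show ?case
    proof (intro allI impI)
      fix y assume "from_right D y i j"
      then show "y = x"
        by (cases rule: from_right.cases) (use prev(3) in \<open>auto\<close>, use prev(2) in \<open>blast\<close>)
    qed
  next
    case prev: (bump_right_bottom i j)
    show ?case
    proof (intro allI impI)
      fix y assume "from_top D y (Suc i) (Suc j)"
      then show "y = x"
        by (cases rule: from_top.cases)
          (use prev(1,3) in \<open>auto dest: pipe_edge_pos\<close>, use prev(2) in \<open>blast\<close>)
    qed
  qed
  then show "from_top D x r c \<Longrightarrow> from_top D y r c \<Longrightarrow> y = x"
    and "from_right D x r c \<Longrightarrow> from_right D y r c \<Longrightarrow> y = x" by blast+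
qed

lemma has_permutationI:
  assumes "\<And>i. i \<ge> 1 \<Longrightarrow> exits_in_row D (w i) i"
  shows "has_permutation D w"
  using assms pipe_edge_unique(2) unfolding has_permutation_def exits_in_row_def by blast

lemma has_permutationD: "has_permutation D w \<Longrightarrow> i \<ge> 1 \<Longrightarrow> from_right D (w i) i 0"
  unfolding has_permutation_def exits_in_row_def by blast

section \<open>Straight runs of crosses and corner swaps in a rectangle\<close>

lemma from_right_straight:
  assumes "from_right D x r c" "c' \<le> c" "\<And>d. c' < d \<Longrightarrow> d \<le> c \<Longrightarrow> (r, d) \<in> D"
  shows "from_right D x r c'"
  using assms(2,1,3)
proof (induction rule: inc_induct)
  case (step m)
  then show ?case using cross_right_left[of D x r m] by simp
qed

lemma from_top_straight:
  assumes "from_top D x r c" "r \<le> r'" "\<And>d. r \<le> d \<Longrightarrow> d < r' \<Longrightarrow> (d, c) \<in> D"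
  shows "from_top D x r' c"
  using assms(2,1,3)
proof (induction rule: dec_induct)
  case (step m)
  then have "from_top D x m c" by simp
  moreover obtain d where "c = Suc d" using pipe_edge_pos(1)[OF step(4)] by (cases c) auto
  ultimately show ?case using cross_top_bottom[of D x m d] step by simp
qed

text \<open>Two pipes run around the border of the rectangle: in \<open>D\<close> one follows row
  \<open>h\<close> and then column \<open>Suc j\<close>, the other column \<open>Suc k\<close> and
  then row \<open>i\<close>, and they cross at the south-west corner. In \<open>D'\<close> they
  exchange routes and bump there. An edge on one of these routes is translated into the entry of the
  new route of its pipe, just after the north-east corner; all other edges keep their pipe. Toggling
  the north-east corner covers both the ladder move and the removal of a double crossing.\<close>

lemma corner_swap_exits:
  assumes hi: "1 \<le> h" "h < i" "j < k"
    and bul: "(h, Suc j) \<notin> D" "(i, Suc k) \<notin> D"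
    and rect: "{h..i} \<times> {Suc j..Suc k} - {(h, Suc j), (i, Suc k), (i, Suc j), (h, Suc k)} \<subseteq> D"
    and diff: "D' - {(i, Suc j), (h, Suc k)} = D - {(i, Suc j), (h, Suc k)}"
    and sw: "(i, Suc j) \<in> D" "(i, Suc j) \<notin> D'"
    and ne: "(h, Suc k) \<in> D \<longleftrightarrow> (h, Suc k) \<notin> D'"
  shows "from_top D x r c \<Longrightarrow>
      (if c = Suc j \<and> h < r \<and> r \<le> i then from_top D' x (Suc h) (Suc k)
       else if c = Suc k \<and> h < r \<and> r \<le> i then from_right D' x h k
       else from_top D' x r c)"
    and "from_right D x r c \<Longrightarrow>
      (if r = h \<and> Suc j \<le> c \<and> c \<le> k then from_top D' x (Suc h) (Suc k)
       else if r = i \<and> Suc j \<le> c \<and> c \<le> k then from_right D' x h k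
       else from_right D' x r c)"
proof -
  have full: "(r, c) \<in> D" if "h \<le> r" "r \<le> i" "Suc j \<le> c" "c \<le> Suc k"
    "(r, c) \<notin> {(h, Suc j), (i, Suc k), (i, Suc j), (h, Suc k)}" for r c
    using rect that by auto
  have agree: "(r, c) \<in> D' \<longleftrightarrow> (r, c) \<in> D" if "(r, c) \<notin> {(i, Suc j), (h, Suc k)}" for r c
    using diff that by blast
  have full': "(r, c) \<in> D'" if "h \<le> r" "r \<le> i" "Suc j \<le> c" "c \<le> Suc k"
    "(r, c) \<notin> {(h, Suc j), (i, Suc k), (i, Suc j), (h, Suc k)}" for r c
    using full[OF that] agree that(5) by simp
  have bul': "(h, Suc j) \<notin> D'" "(i, Suc k) \<notin> D'"
    using bul agree hi by auto
  have bump_cases: "r = h \<and> c = k \<or> r = h \<and> c = j \<or> r = i \<and> c = k \<or>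
      (r, Suc c) \<notin> D' \<and> (r < h \<or> i < r \<or> c < j \<or> k < c)" if "(r, Suc c) \<notin> D" for r c
  proof (cases "(r, Suc c) \<in> {(h, Suc j), (i, Suc k), (i, Suc j), (h, Suc k)}")
    case True
    then show ?thesis using that sw(1) by auto
  next
    case False
    then have "\<not> (h \<le> r \<and> r \<le> i \<and> Suc j \<le> Suc c \<and> Suc c \<le> Suc k)" using full that by metis
    then have "r < h \<or> i < r \<or> c < j \<or> k < c" by linarith
    moreover have "(r, Suc c) \<notin> D'" using False agree that by simp
    ultimately show ?thesis by simp
  qed
  have out_left: "from_right D' x i j" if "from_right D' x h k"
  proof -
    have "from_right D' x h (Suc j)"
      by (rule from_right_straight[OF that]) (use hi in \<open>auto intro!: full'\<close>)
    then have "from_top D' x (Suc h) (Suc j)" using bul'(1) bump_right_bottom by blast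
    then have "from_top D' x i (Suc j)"
      by (rule from_top_straight) (use hi in \<open>auto intro!: full'\<close>)
    then show ?thesis using sw(2) bump_top_left by blast
  qed
  have out_bottom: "from_top D' x (Suc i) (Suc j)" if "from_top D' x (Suc h) (Suc k)"
  proof -
    have "from_top D' x i (Suc k)"
      by (rule from_top_straight[OF that]) (use hi in \<open>auto intro!: full'\<close>)
    then have "from_right D' x i k" using bul'(2) bump_top_left by blast
    then have "from_right D' x i (Suc j)"
      by (rule from_right_straight) (use hi in \<open>auto intro!: full'\<close>)
    then show ?thesis using sw(2) bump_right_bottom by blast
  qed
  show "from_top D x r c \<Longrightarrow>
      (if c = Suc j \<and> h < r \<and> r \<le> i then from_top D' x (Suc h) (Suc k)
       else if c = Suc k \<and> h < r \<and> r \<le> i then from_right D' x h k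
       else from_top D' x r c)"
    and "from_right D x r c \<Longrightarrow>
      (if r = h \<and> Suc j \<le> c \<and> c \<le> k then from_top D' x (Suc h) (Suc k)
       else if r = i \<and> Suc j \<le> c \<and> c \<le> k then from_right D' x h k
       else from_right D' x r c)"
  proof (induction rule: from_top_from_right.inducts)
    case start
    then show ?case using hi from_top_from_right.start[of x D'] by auto
  next
    case (cross_top_bottom r c)
    then have "(r, Suc c) \<noteq> (h, Suc j)" "(r, Suc c) \<noteq> (i, Suc k)" using bul by auto
    then consider "r = i" "c = j" | "r = h" "c = k" | "(r, Suc c) \<in> D'"
      "(r, Suc c) \<notin> {(i, Suc j), (h, Suc k), (h, Suc j), (i, Suc k)}"
      using cross_top_bottom agree by blast
    then show ?case
    proof cases
      case 1
      then show ?thesis using cross_top_bottom hi out_bottom by auto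
    next
      case 2
      then have "(h, Suc k) \<notin> D'" using cross_top_bottom ne by simp
      then show ?thesis using 2 cross_top_bottom hi bump_top_left[of D' x h k] by auto
    next
      case 3
      have e: "(Suc c = Suc j \<and> h < Suc r \<and> Suc r \<le> i) = (Suc c = Suc j \<and> h < r \<and> r \<le> i)"
        "(Suc c = Suc k \<and> h < Suc r \<and> Suc r \<le> i) = (Suc c = Suc k \<and> h < r \<and> r \<le> i)"
        using 3(2) hi by auto
      show ?thesis
        using cross_top_bottom(2) from_top_from_right.cross_top_bottom[OF _ 3(1), of x]
        by (simp only: e if_bool_eq_conj) blast
    qed
  next
    case (bump_top_left r c)
    then consider "r = h" "c = k" | "r = h" "c = j" | "r = i" "c = k" | "(r, Suc c) \<notin> D'"
      "r < h \<or> i < r \<or> c < j \<or> k < c"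
      using bump_cases by blast
    then show ?case
    proof cases
      case 1
      then have "(h, Suc k) \<in> D'" using bump_top_left ne by simp
      then show ?thesis using 1 bump_top_left hi cross_top_bottom[of D' x h k] by auto
    next
      case 2
      then show ?thesis
        using bump_top_left hi bul' from_top_from_right.bump_top_left[of D' x h j] by auto
    next
      case 3
      then show ?thesis using bump_top_left hi by auto
    next
      case 4
      have e: "(Suc c = Suc j \<and> h < r \<and> r \<le> i) = False"
        "(Suc c = Suc k \<and> h < r \<and> r \<le> i) = False"
        "(r = h \<and> Suc j \<le> c \<and> c \<le> k) = False"
        "(r = i \<and> Suc j \<le> c \<and> c \<le> k) = False"
        using 4(2) hi by auto
      show ?thesis
        using bump_top_left(2) from_top_from_right.bump_top_left[OF _ 4(1), of x]
        by (simp only: e if_False)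
    qed
  next
    case (cross_right_left r c)
    then have "(r, Suc c) \<noteq> (h, Suc j)" "(r, Suc c) \<noteq> (i, Suc k)" using bul by auto
    then consider "r = i" "c = j" | "r = h" "c = k" | "(r, Suc c) \<in> D'"
      "(r, Suc c) \<notin> {(i, Suc j), (h, Suc k), (h, Suc j), (i, Suc k)}"
      using cross_right_left agree by blast
    then show ?case
    proof cases
      case 1
      then show ?thesis using cross_right_left hi out_left by auto
    next
      case 2
      then have "(h, Suc k) \<notin> D'" using cross_right_left ne by simp
      then show ?thesis using 2 cross_right_left hi bump_right_bottom[of D' x h k] by auto
    next
      case 3
      have e: "(r = h \<and> Suc j \<le> c \<and> c \<le> k) = (r = h \<and> Suc j \<le> Suc c \<and> Suc c \<le> k)"
        "(r = i \<and> Suc j \<le> c \<and> c \<le> k) = (r = i \<and> Suc j \<le> Suc c \<and> Suc c \<le> k)"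
        using 3(2) hi by auto
      show ?thesis
        using cross_right_left(2) from_top_from_right.cross_right_left[OF _ 3(1), of x]
        by (simp only: e if_bool_eq_conj) blast
    qed
  next
    case (bump_right_bottom r c)
    then consider "r = h" "c = k" | "r = h" "c = j" | "r = i" "c = k" | "(r, Suc c) \<notin> D'"
      "r < h \<or> i < r \<or> c < j \<or> k < c"
      using bump_cases by blast
    then show ?case
    proof cases
      case 1
      then have "(h, Suc k) \<in> D'" using bump_right_bottom ne by simp
      then show ?thesis using 1 bump_right_bottom hi cross_right_left[of D' x h k] by auto
    next
      case 2
      then show ?thesis using bump_right_bottom hi by auto
    next
      case 3
      then show ?thesis
        using bump_right_bottom hi bul' from_top_from_right.bump_right_bottom[of D' x i k] by auto
    next
      case 4
      have e: "(r = h \<and> Suc j \<le> Suc c \<and> Suc c \<le> k) = False"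
        "(r = i \<and> Suc j \<le> Suc c \<and> Suc c \<le> k) = False"
        "(Suc c = Suc j \<and> h < Suc r \<and> Suc r \<le> i) = False"
        "(Suc c = Suc k \<and> h < Suc r \<and> Suc r \<le> i) = False"
        using 4(2) hi by auto
      show ?thesis
        using bump_right_bottom(2) from_top_from_right.bump_right_bottom[OF _ 4(1), of x]
        by (simp only: e if_False)
    qed
  qed
qed

lemma corner_swap_permutation:
  assumes w: "has_permutation D w"
    and hi: "1 \<le> h" "h < i" "1 \<le> j" "j < k"
    and bul: "(h, j) \<notin> D" "(i, k) \<notin> D"
    and rect: "{h..i} \<times> {j..k} - {(h, j), (i, k), (i, j), (h, k)} \<subseteq> D"
    and diff: "D' - {(i, j), (h, k)} = D - {(i, j), (h, k)}"
    and sw: "(i, j) \<in> D" "(i, j) \<notin> D'"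
    and ne: "(h, k) \<in> D \<longleftrightarrow> (h, k) \<notin> D'"
  shows "has_permutation D' w"
proof (rule has_permutationI)
  fix p :: nat assume "p \<ge> 1"
  then have "from_right D (w p) p 0" using w has_permutationD by blast
  moreover obtain j0 k0 where jk: "j = Suc j0" "k = Suc k0" using hi by (cases j; cases k) auto
  have "j0 < k0" using hi(4) jk by simp
  note swap = corner_swap_exits(2)[OF hi(1,2) this bul[unfolded jk] rect[unfolded jk] diff[unfolded jk]
      sw[unfolded jk] ne[unfolded jk]]
  ultimately have "from_right D' (w p) p 0"
    using swap[of "w p" p 0] by simp
  then show "exits_in_row D' (w p) p" unfolding exits_in_row_def .
qed

text \<open>
  Below the lowest row of crosses and to the left of its first cross \<open>(i, Suc j)\<close> all tiles are bumps,
  so the two pipes through this cross leave it along neighbouring staircases ending in rows \<open>i + j\<close>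
  and \<open>i + j + 1\<close>.
\<close>

lemma remove_last_cross_exits:
  assumes c: "1 \<le> i" "(i, Suc j) \<in> D"
    and last: "\<forall>(r, c) \<in> D. r \<le> i \<and> (r = i \<longrightarrow> Suc j \<le> c)"
    and D': "D' = D - {(i, Suc j)}"
  shows "from_top D x p q \<Longrightarrow>
      (if i < p \<and> p + q = i + Suc j then from_top D' x (Suc p) q
       else if i < p \<and> p + q = i + Suc (Suc j) then from_top D' x (p - 1) q
       else from_top D' x p q)"
    and "from_right D x p q \<Longrightarrow>
      (if i \<le> p \<and> p + q = i + j then from_right D' x (Suc p) q
       else if i < p \<and> p + q = i + Suc j then from_right D' x (p - 1) q
       else from_right D' x p q)"
proof -
  have below: "r \<le> i" if "(r, c) \<in> D" for r c using last that by blast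
  have left: "Suc j \<le> c" if "(i, c) \<in> D" for c using last that by blast
  have bumps: "i < r \<or> r = i \<and> c \<le> Suc j \<Longrightarrow> (r, c) \<notin> D'" for r c
    using below[of r c] left[of c] D' by auto
  show "from_top D x p q \<Longrightarrow>
      (if i < p \<and> p + q = i + Suc j then from_top D' x (Suc p) q
       else if i < p \<and> p + q = i + Suc (Suc j) then from_top D' x (p - 1) q
       else from_top D' x p q)"
    and "from_right D x p q \<Longrightarrow>
      (if i \<le> p \<and> p + q = i + j then from_right D' x (Suc p) q
       else if i < p \<and> p + q = i + Suc j then from_right D' x (p - 1) q
       else from_right D' x p q)"
  proof (induction rule: from_top_from_right.inducts)
    case start
    then show ?case using c from_top_from_right.start[of x D'] by auto
  next
    case (cross_top_bottom r q)
    have *: "r \<le> i" "r = i \<Longrightarrow> j \<le> q"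
      using cross_top_bottom below[of r "Suc q"] left[of "Suc q"] by auto
    show ?case
    proof (cases "r = i \<and> q = j")
      case True
      then show ?thesis using cross_top_bottom * by auto
    next
      case False
      then have "(r, Suc q) \<in> D'" using cross_top_bottom D' by auto
      then show ?thesis using cross_top_bottom * False from_top_from_right.cross_top_bottom[of D' x r q]
        by auto
    qed
  next
    case (bump_top_left r q)
    consider "i < r" "r + q = i + j" | "i < r" "r + q = Suc (i + j)"
      | "\<not> (i < r \<and> r + q = i + j)" "\<not> (i < r \<and> r + q = Suc (i + j))" by auto
    then show ?case
    proof cases
      case 1
      then show ?thesis
        using bump_top_left bumps from_top_from_right.bump_top_left[of D' x "Suc r" q] by auto
    next
      case 2
      then have "r - 1 > i \<or> r - 1 = i \<and> q = j" by auto
      \<comment> \<open>For \<open>r = i + 1\<close> this tile is the removed cross itself, now a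
        bump.\<close>
      then have "(r - 1, Suc q) \<notin> D'" using bumps by auto
      then show ?thesis
        using 2 bump_top_left from_top_from_right.bump_top_left[of D' x "r - 1" q] by auto
    next
      case 3
      moreover have "\<not> (r = i \<and> q = j)" using bump_top_left c by auto
      ultimately show ?thesis
        using bump_top_left D' from_top_from_right.bump_top_left[of D' x r q] by auto
    qed
  next
    case (cross_right_left r q)
    have *: "r \<le> i" "r = i \<Longrightarrow> j \<le> q"
      using cross_right_left below[of r "Suc q"] left[of "Suc q"] by auto
    show ?case
    proof (cases "r = i \<and> q = j")
      case True
      then have "from_right D' x i (Suc j)" using cross_right_left by auto
      then have "from_top D' x (Suc i) (Suc j)" using bumps bump_right_bottom by auto
      then have "from_right D' x (Suc i) j" using bumps bump_top_left by auto
      then show ?thesis using True by auto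
    next
      case False
      then have "(r, Suc q) \<in> D'" using cross_right_left D' by auto
      moreover have "\<not> (r = i \<and> Suc (r + q) = i + j)" using * by auto
      ultimately show ?thesis
        using cross_right_left * False from_top_from_right.cross_right_left[of D' x r q] by auto
    qed
  next
    case (bump_right_bottom r q)
    consider "i \<le> r" "Suc (r + q) = i + j" | "i < r" "r + q = i + j"
      | "\<not> (i \<le> r \<and> Suc (r + q) = i + j)" "\<not> (i < r \<and> r + q = i + j)" by auto
    then show ?case
    proof cases
      case 1
      then show ?thesis
        using bump_right_bottom bumps from_top_from_right.bump_right_bottom[of D' x "Suc r" q] by auto
    next
      case 2
      then have "r - 1 > i \<or> r - 1 = i \<and> Suc q \<le> Suc j" by auto
      then have "(r - 1, Suc q) \<notin> D'" using bumps by blast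
      then show ?thesis
        using 2 bump_right_bottom from_top_from_right.bump_right_bottom[of D' x "r - 1" q] by auto
    next
      case 3
      moreover have "\<not> (r = i \<and> q = j)" using bump_right_bottom c by auto
      ultimately show ?thesis
        using bump_right_bottom D' from_top_from_right.bump_right_bottom[of D' x r q] by auto
    qed
  qed
qed

text \<open>The last cross contributes the adjacent transposition of the two rows in which its pipes
  exit. This makes induction on the number of crosses possible.\<close>

lemma remove_last_cross_permutation:
  assumes w: "has_permutation D w"
    and c: "1 \<le> i" "1 \<le> j" "(i, j) \<in> D"
    and last: "\<forall>(r, c) \<in> D. r \<le> i \<and> (r = i \<longrightarrow> j \<le> c)"
  shows "has_permutation (D - {(i, j)}) (w \<circ> transpose (i + j - 1) (i + j))"
proof (rule has_permutationI)
  fix p :: nat assume p: "p \<ge> 1"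
  obtain j0 where j: "j = Suc j0" using c by (cases j) auto
  define p' where "p' = transpose (i + j - 1) (i + j) p"
  have "p' \<ge> 1" using p c unfolding p'_def transpose_def by auto
  then have "from_right D (w p') p' 0" using w has_permutationD by blast
  from remove_last_cross_exits(2)[OF c(1) c(3)[unfolded j] last[unfolded j] refl this]
  have "from_right (D - {(i, j)}) (w p') p 0"
    using c p unfolding p'_def transpose_def j by (auto split: if_splits)
  then show "exits_in_row (D - {(i, j)}) ((w \<circ> transpose (i + j - 1) (i + j)) p) p"
    unfolding exits_in_row_def p'_def by simp
qed

section \<open>Reduced pipe dreams\<close>

text \<open>The usual change of length at a descent. It is an equality of sets because finiteness
  has to be derived along with the cardinality.\<close>

lemma inversions_comp_transpose:
  assumes m: "1 \<le> m" and gt: "w m > w (Suc m)"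
  shows "inversions w =
    insert (m, Suc m) (map_prod (transpose m (Suc m)) (transpose m (Suc m)) `
      inversions (w \<circ> transpose m (Suc m)))"
    (is "_ = insert _ (?f ` _)")
    and "(m, Suc m) \<notin> map_prod (transpose m (Suc m)) (transpose m (Suc m)) `
      inversions (w \<circ> transpose m (Suc m))"
proof -
  let ?s = "transpose m (Suc m)"
  have s: "?s p = (if p = m then Suc m else if p = Suc m then m else p)" for p
    by (simp add: transpose_def)
  have mem: "(a, b) \<in> ?f ` inversions (w \<circ> ?s) \<longleftrightarrow> (?s a, ?s b) \<in> inversions (w \<circ> ?s)" for a b
  proof
    assume "(?s a, ?s b) \<in> inversions (w \<circ> ?s)"
    then have "?f (?s a, ?s b) \<in> ?f ` inversions (w \<circ> ?s)" by (rule imageI)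
    then show "(a, b) \<in> ?f ` inversions (w \<circ> ?s)" by simp
  qed auto
  show "(m, Suc m) \<notin> ?f ` inversions (w \<circ> ?s)"
    unfolding mem by (simp add: inversions_def s)
  show "inversions w = insert (m, Suc m) (?f ` inversions (w \<circ> ?s))"
  proof (rule set_eqI)
    fix x :: "nat \<times> nat"
    obtain a b where x: "x = (a, b)" by fastforce
    show "x \<in> inversions w \<longleftrightarrow> x \<in> insert (m, Suc m) (?f ` inversions (w \<circ> ?s))"
      unfolding x insert_iff mem using m gt by (auto simp: inversions_def s)
  qed
qed

lemma card_inversions_comp_transpose:
  assumes "1 \<le> m" "w m > w (Suc m)" "finite (inversions (w \<circ> transpose m (Suc m)))"
  shows "finite (inversions w)"
    and "card (inversions w) = Suc (card (inversions (w \<circ> transpose m (Suc m))))"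
proof -
  let ?s = "transpose m (Suc m)"
  have inj: "inj_on (map_prod ?s ?s) A" for A
    by (rule inj_on_inverseI[where g = "map_prod ?s ?s"]) auto
  show "finite (inversions w)" "card (inversions w) = Suc (card (inversions (w \<circ> ?s)))"
    unfolding inversions_comp_transpose(1)[OF assms(1,2)]
    using inversions_comp_transpose(2)[OF assms(1,2)] assms(3) by (auto simp: card_image[OF inj])
qed

lemma last_cross_exists:
  assumes "pipe_dream D" "D \<noteq> {}"
  obtains i j where "1 \<le> i" "1 \<le> j" "(i, j) \<in> D" "\<forall>(r, c) \<in> D. r \<le> i \<and> (r = i \<longrightarrow> j \<le> c)"
proof -
  define i where "i = Max (fst ` D)"
  define j where "j = Min {c. (i, c) \<in> D}"
  have fin: "finite D" using assms(1) by (simp add: pipe_dream_def)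
  have "{c. (i, c) \<in> D} \<subseteq> snd ` D" by force
  then have fin_row: "finite {c. (i, c) \<in> D}" using fin finite_subset by blast
  have "i \<in> fst ` D" unfolding i_def using fin assms(2) by (intro Max_in) auto
  then have "{c. (i, c) \<in> D} \<noteq> {}" by force
  then have ij: "(i, j) \<in> D" using Min_in[OF fin_row] unfolding j_def by blast
  show thesis
  proof
    show "1 \<le> i" "1 \<le> j" using ij assms(1) by (auto simp: pipe_dream_def)
    show "\<forall>(r, c) \<in> D. r \<le> i \<and> (r = i \<longrightarrow> j \<le> c)"
      using fin fin_row unfolding i_def[symmetric] j_def
      by (auto simp: i_def intro!: Min_le Max_ge rev_image_eqI)
  qed (fact ij)
qed

lemma no_cross_exits:
  assumes "1 \<le> p" "p \<le> x"
  shows "from_top {} x p (Suc (x - p))"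
  using assms
proof (induction p rule: dec_induct)
  case base
  then show ?case using start[of x "{}"] by simp
next
  case (step p)
  then have "from_right {} x p (Suc (x - Suc p))" using bump_top_left[of "{}" x p "x - p"]
    by (simp add: Suc_diff_Suc)
  then show ?case using bump_right_bottom by blast
qed

text \<open>Removing the last cross composes \<open>w\<close> with an adjacent transposition and so
  changes the number of inversions by exactly one, up or down. Since \<open>w\<close> is an
  arbitrary function here, injectivity and finiteness travel along: the former separates
  \<open>w m\<close> from \<open>w (Suc m)\<close>, the latter gives \<open>card\<close> its
  meaning.\<close>

lemma card_inversions_le:
  assumes "pipe_dream D" "has_permutation D w"
  shows "inj_on w {1..} \<and> finite (inversions w) \<and> card (inversions w) \<le> card D"
  using assms
proof (induction "card D" arbitrary: D w)
  case 0
  then have D: "D = {}" by (simp add: pipe_dream_def)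
  have w: "w p = p" if "p \<ge> 1" for p
  proof -
    have "from_right {} p p 0" using no_cross_exits[of p p] that bump_top_left[of "{}" p p 0] by simp
    then show ?thesis
      using has_permutationD[OF 0(3)] that pipe_edge_unique(2) unfolding D by blast
  qed
  then have "inversions w = {}" by (auto simp: inversions_def)
  then show ?case using w by (auto simp: inj_on_def)
next
  case (Suc n)
  then have "D \<noteq> {}" by auto
  then obtain i j where ij: "1 \<le> i" "1 \<le> j" "(i, j) \<in> D"
      "\<forall>(r, c) \<in> D. r \<le> i \<and> (r = i \<longrightarrow> j \<le> c)"
    using last_cross_exists[OF Suc.prems(1)] by blast
  define m where "m = i + j - 1"
  have m: "1 \<le> m" "i + j = Suc m" using ij by (auto simp: m_def)
  let ?s = "transpose m (Suc m)"
  let ?D = "D - {(i, j)}"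
  have D': "pipe_dream ?D" "card ?D = n" using Suc ij by (auto simp: pipe_dream_def)
  have "has_permutation ?D (w \<circ> ?s)"
    using remove_last_cross_permutation[OF Suc.prems(2) ij] m by simp
  then have IH: "inj_on (w \<circ> ?s) {1..}" "finite (inversions (w \<circ> ?s))" "card (inversions (w \<circ> ?s)) \<le> n"
    using Suc.hyps(1)[of ?D] D' by auto
  have "?s ` {1..} \<subseteq> {1..}" using m by (auto simp: transpose_def)
  have inj: "inj_on w {1..}"
  proof (rule inj_onI)
    fix x y assume xy: "x \<in> {1..}" "y \<in> {1..}" "w x = w y"
    have "?s x = ?s y"
      by (rule inj_onD[OF IH(1)]) (use xy \<open>?s ` {1..} \<subseteq> {1..}\<close> in auto)
    then show "x = y" by (metis transpose_involutory)
  qed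
  have "w m \<noteq> w (Suc m)" using inj_onD[OF inj, of m "Suc m"] m(1) by auto
  then consider "w m > w (Suc m)" | "(w \<circ> ?s) m > (w \<circ> ?s) (Suc m)" by fastforce
  then show ?case
  proof cases
    case 1
    then show ?thesis
      using card_inversions_comp_transpose[OF m(1) 1 IH(2)] inj IH(3) Suc.hyps(2) by simp
  next
    case 2
    \<comment> \<open>An ascent of \<open>w\<close> at \<open>m\<close> is a descent of
      \<open>w \<circ> ?s\<close>, so the descent lemma is applied with the roles exchanged.\<close>
    have id: "w \<circ> ?s \<circ> ?s = w" by (simp add: comp_assoc)
    have "inversions (w \<circ> ?s) = insert (m, Suc m) (map_prod ?s ?s ` inversions w)"
      using inversions_comp_transpose(1)[OF m(1) 2] unfolding id .
    then have "finite (map_prod ?s ?s ` inversions w)" using IH(2) by (metis finite_insert)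
    moreover have "inj_on (map_prod ?s ?s) (inversions w)"
      by (rule inj_on_inverseI[where g = "map_prod ?s ?s"]) auto
    ultimately have fin: "finite (inversions w)" using finite_imageD by blast
    then have "card (inversions (w \<circ> ?s)) = Suc (card (inversions w))"
      using card_inversions_comp_transpose(2)[OF m(1) 2] unfolding id by blast
    then show ?thesis using inj fin IH(3) Suc.hyps(2) by simp
  qed
qed

text \<open>Reducedness forces \<open>w\<close> to have a descent at \<open>m = i + j - 1\<close>
  for the last cross \<open>(i, j)\<close>: at an ascent, its removal would leave too few crosses
  for the longer permutation. A permutation of \<open>{1..n}\<close> has no descent at
  \<open>m \<ge> n\<close>, hence \<open>i + j \<le> n\<close>, and the remaining crosses form a
  reduced pipe dream of another permutation of \<open>{1..n}\<close>.\<close>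

lemma RPD_triangle:
  assumes "w permutes {1..n}" "D \<in> RPD w" "(p, q) \<in> D"
  shows "p + q \<le> n"
  using assms
proof (induction "card D" arbitrary: D w)
  case 0
  then show ?case by (auto simp: RPD_def pipe_dream_def)
next
  case (Suc N)
  have D: "pipe_dream D" "has_permutation D w" "card D = card (inversions w)"
    using Suc.prems by (auto simp: RPD_def)
  obtain i j where ij: "1 \<le> i" "1 \<le> j" "(i, j) \<in> D"
      "\<forall>(r, c) \<in> D. r \<le> i \<and> (r = i \<longrightarrow> j \<le> c)"
    using last_cross_exists[OF D(1)] Suc.prems(3) by blast
  define m where "m = i + j - 1"
  have m: "1 \<le> m" "i + j = Suc m" using ij by (auto simp: m_def)
  let ?s = "transpose m (Suc m)"
  let ?D = "D - {(i, j)}"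
  have D': "pipe_dream ?D" "card ?D = N" using D Suc.hyps(2) ij by (auto simp: pipe_dream_def)
  have perm: "has_permutation ?D (w \<circ> ?s)"
    using remove_last_cross_permutation[OF D(2) ij] m by simp
  then have le: "finite (inversions (w \<circ> ?s))" "card (inversions (w \<circ> ?s)) \<le> N"
    using card_inversions_le[OF D'(1)] D'(2) by auto
  have gt: "w m > w (Suc m)"
  proof (rule ccontr)
    assume "\<not> w m > w (Suc m)"
    moreover have "w m \<noteq> w (Suc m)" using Suc.prems(1) by (metis n_not_Suc_n permutes_inv_eq)
    ultimately have 2: "(w \<circ> ?s) m > (w \<circ> ?s) (Suc m)" by simp
    have id: "w \<circ> ?s \<circ> ?s = w" by (simp add: comp_assoc)
    have "finite (inversions w)" using card_inversions_le[OF D(1,2)] by simp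
    then have "card (inversions (w \<circ> ?s)) = Suc (card (inversions w))"
      using card_inversions_comp_transpose(2)[OF m(1) 2] unfolding id by blast
    then show False using le D(3) Suc.hyps(2) by simp
  qed
  have mn: "Suc m \<le> n"
  proof (rule ccontr)
    assume "\<not> Suc m \<le> n"
    then have "w (Suc m) = Suc m" using permutes_not_in[OF Suc.prems(1)] by simp
    moreover have "w m \<le> max m n"
      using permutes_not_in[OF Suc.prems(1), of m] permutes_in_image[OF Suc.prems(1), of m]
      by (cases "m \<in> {1..n}") auto
    ultimately show False using gt \<open>\<not> Suc m \<le> n\<close> by simp
  qed
  show ?case
  proof (cases "(p, q) = (i, j)")
    case True
    then show ?thesis using m mn by simp
  next
    case False
    have "?s permutes {1..n}" using m mn by (intro permutes_swap_id) auto
    then have "w \<circ> ?s permutes {1..n}" using permutes_compose Suc.prems(1) by blast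
    moreover have "?D \<in> RPD (w \<circ> ?s)"
      using D' perm card_inversions_comp_transpose(2)[OF m(1) gt le(1)] D(3) Suc.hyps(2)
      by (simp add: RPD_def)
    ultimately show ?thesis using Suc.hyps(1)[of ?D] D'(2) Suc.prems(3) False by simp
  qed
qed

text \<open>Replacing both crossings by bumps keeps the permutation and leaves fewer crosses than
  inversions.\<close>

lemma RPD_no_double_crossing:
  assumes D: "D \<in> RPD w" and hi: "1 \<le> h" "h < i" "1 \<le> j" "j < k"
    and bul: "(h, j) \<notin> D" "(i, k) \<notin> D"
    and rect: "{h..i} \<times> {j..k} - {(h, j), (i, k)} \<subseteq> D"
  shows False
proof -
  let ?D = "D - {(i, j), (h, k)}"
  have in_D: "(i, j) \<in> D" "(h, k) \<in> D" using rect hi by auto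
  have fin: "pipe_dream D" "has_permutation D w" "card D = card (inversions w)" "finite D"
    using D by (auto simp: RPD_def pipe_dream_def)
  have "has_permutation ?D w"
    by (rule corner_swap_permutation[OF fin(2) hi bul]) (use rect in_D in auto)
  moreover have "pipe_dream ?D" using fin(1) by (auto simp: pipe_dream_def)
  ultimately have "card D \<le> card ?D" using card_inversions_le fin(3) by metis
  moreover have "card ?D < card D" using in_D fin(4) by (intro psubset_card_mono) auto
  ultimately show False by simp
qed

lemma ladder_move_RPD:
  assumes "D \<in> RPD w" "ladder_move i j D D'"
  shows "D' \<in> RPD w"
proof -
  obtain h k where r: "ladder_rect D i j h k" and D': "D' = insert (h, k) (D - {(i, j)})"
    using assms(2) by (auto simp: ladder_move_def)
  have fin: "pipe_dream D" "has_permutation D w" "card D = card (inversions w)" "finite D"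
    using assms(1) by (auto simp: RPD_def pipe_dream_def)
  have *: "1 \<le> h" "h < i" "1 \<le> j" "j < k" "(h, j) \<notin> D" "(i, k) \<notin> D" "(i, j) \<in> D" "(h, k) \<notin> D"
      "{h..i} \<times> {j..k} - {(h, j), (i, k), (i, j), (h, k)} \<subseteq> D"
    using r unfolding ladder_rect_def by auto
  have "has_permutation D' w"
    by (rule corner_swap_permutation[OF fin(2) *(1-6) *(9)]) (use * D' in auto)
  moreover have "pipe_dream D'" using fin(1) * D' by (auto simp: pipe_dream_def)
  moreover have "card D' = card D"
    using * fin(4) unfolding D' by (simp del: card_Diff_insert add: card_Suc_Diff1)
  ultimately show ?thesis using fin(3) by (simp add: RPD_def)
qed

section \<open>Ladder moves and south-west closed sets\<close>

abbreviation ladder_le :: "tile set \<Rightarrow> tile set \<Rightarrow> bool" where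
  "ladder_le \<equiv> (\<lambda>E E'. \<exists>i j. ladder_move i j E E')\<^sup>*\<^sup>*"

lemma ladder_le_step: "ladder_rect D i j h k \<Longrightarrow> ladder_le D (insert (h, k) (D - {(i, j)}))"
  by (rule r_into_rtranclp) (auto simp: ladder_move_def)

lemma ladder_le_RPD: "ladder_le D D' \<Longrightarrow> D \<in> RPD w \<Longrightarrow> D' \<in> RPD w"
  by (induction rule: rtranclp_induct) (auto intro: ladder_move_RPD)

lemma RPD_finite: "D \<in> RPD w \<Longrightarrow> finite D"
  by (simp add: RPD_def pipe_dream_def)

lemma RPD_pos: "D \<in> RPD w \<Longrightarrow> (r, c) \<in> D \<Longrightarrow> 1 \<le> r \<and> 1 \<le> c"
  by (auto simp: RPD_def pipe_dream_def)

definition sw_closed :: "tile set \<Rightarrow> bool" where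
  "sw_closed I \<longleftrightarrow> (\<forall>r c r' c'. (r, c) \<in> I \<longrightarrow> r \<le> r' \<longrightarrow> c' \<le> c \<longrightarrow> (r', c') \<in> I)"

text \<open>Besides controlling south-west closed sets, the sum over \<open>UNIV\<close> is the
  measure of the outer induction for optimality.\<close>

definition row_sum :: "tile set \<Rightarrow> tile set \<Rightarrow> nat" where
  "row_sum I D = (\<Sum>(r, c)\<in>D \<inter> I. r)"

lemma row_sum_ladder:
  assumes "finite D" "sw_closed I" "ladder_rect D p q u v"
  shows "row_sum I (insert (u, v) (D - {(p, q)})) \<le> row_sum I D"
    and "(p, q) \<in> I \<Longrightarrow> row_sum I (insert (u, v) (D - {(p, q)})) < row_sum I D"
proof -
  let ?E = "insert (u, v) (D - {(p, q)})"
  have r: "u < p" "q < v" "(p, q) \<in> D" "(u, v) \<notin> D" using assms(3) by (auto simp: ladder_rect_def)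
  have less: "row_sum I ?E < row_sum I D" if "(p, q) \<in> I"
  proof -
    have "row_sum I D = p + row_sum I (D - {(p, q)})"
      using that r(3) assms(1) sum.remove[of "D \<inter> I" "(p, q)" "\<lambda>(r, c). r"]
      by (simp add: row_sum_def Diff_Int_distrib2)
    moreover have "row_sum I ?E \<le> u + row_sum I (D - {(p, q)})"
      using r(4) assms(1) by (cases "(u, v) \<in> I") (auto simp: row_sum_def Int_insert_left)
    ultimately show ?thesis using r(1) by simp
  qed
  moreover have "row_sum I ?E = row_sum I D" if "(p, q) \<notin> I"
  proof -
    have "(u, v) \<notin> I" using that assms(2) r unfolding sw_closed_def by (meson less_imp_le)
    then have "?E \<inter> I = D \<inter> I" using that by auto
    then show ?thesis by (simp add: row_sum_def)
  qed
  ultimately show "row_sum I ?E \<le> row_sum I D" "(p, q) \<in> I \<Longrightarrow> row_sum I ?E < row_sum I D"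
    by (cases "(p, q) \<in> I"; simp)+
qed

lemma row_sum_ladder_le:
  assumes "ladder_le D E" "finite D" "sw_closed I"
  shows "finite E \<and> row_sum I E \<le> row_sum I D"
  using assms
proof (induction rule: rtranclp_induct)
  case (step E F)
  then show ?case using row_sum_ladder(1)[of E I] by (fastforce simp: ladder_move_def)
qed simp

text \<open>Equal sums at both ends leave no room for a drop at the first move. Only this move is
  split off, as the induction treats one ladder move followed by a chain.\<close>

lemma ladder_agree:
  assumes "finite D" "sw_closed I" "ladder_rect D p q u v"
    and "ladder_le (insert (u, v) (D - {(p, q)})) D2" and "D \<inter> I = D2 \<inter> I"
  shows "(p, q) \<notin> I" and "insert (u, v) (D - {(p, q)}) \<inter> I = D2 \<inter> I"
proof -
  have "row_sum I D2 = row_sum I D" using assms(5) by (simp add: row_sum_def)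
  moreover have "row_sum I D2 \<le> row_sum I (insert (u, v) (D - {(p, q)}))"
    using row_sum_ladder_le[OF assms(4)] assms(1,2) by simp
  ultimately show pq: "(p, q) \<notin> I" using row_sum_ladder(2)[OF assms(1-3)] by fastforce
  have "(u, v) \<notin> I"
    using pq assms(2,3) unfolding sw_closed_def ladder_rect_def by (meson less_imp_le)
  then show "insert (u, v) (D - {(p, q)}) \<inter> I = D2 \<inter> I" using pq assms(5) by auto
qed

text \<open>The last clause goes from bumps to corners: the later case distinctions find a known
  bump inside a ladder rectangle and conclude that it is a corner or impossible.\<close>

lemma ladder_rectD:
  assumes "ladder_rect D p q u v"
  shows "1 \<le> u" "u < p" "1 \<le> q" "q < v" "(p, q) \<in> D" "(u, q) \<notin> D" "(p, v) \<notin> D" "(u, v) \<notin> D"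
    and "\<And>r c. u \<le> r \<Longrightarrow> r \<le> p \<Longrightarrow> q \<le> c \<Longrightarrow> c \<le> v \<Longrightarrow>
      (r, c) \<notin> D \<Longrightarrow> r = u \<and> c = q \<or> r = p \<and> c = v \<or> r = u \<and> c = v"
  using assms by (auto simp: ladder_rect_def subset_iff)

lemma ladder_rectI:
  assumes "1 \<le> u" "u < p" "1 \<le> q" "q < v" "(p, q) \<in> D" "(u, q) \<notin> D" "(p, v) \<notin> D" "(u, v) \<notin> D"
    and "\<And>r c. u \<le> r \<Longrightarrow> r \<le> p \<Longrightarrow> q \<le> c \<Longrightarrow> c \<le> v \<Longrightarrow>
      (r, c) \<notin> {(u, q), (p, v), (u, v)} \<Longrightarrow> (r, c) \<in> D"
  shows "ladder_rect D p q u v"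
  using assms by (auto simp: ladder_rect_def subset_iff)

lemma ladder_rect_unique:
  assumes "ladder_rect D i j h k" "ladder_rect D i j h' k'"
  shows "h' = h" "k' = k"
proof -
  note 1 = ladder_rectD[OF assms(1)] note 2 = ladder_rectD[OF assms(2)]
  show "h' = h" using 1(1-8) 2(1-8) 1(9)[of h' j] 2(9)[of h j] by (cases h h' rule: linorder_cases) auto
  show "k' = k" using 1(1-8) 2(1-8) 1(9)[of i k'] 2(9)[of i k] by (cases k k' rule: linorder_cases) auto
qed

section \<open>Move operators\<close>

text \<open>The tile \<open>(i, j)\<close> is movable, and \<open>h\<close>, \<open>k\<close> are its \<open>rect_top\<close> and \<open>rect_right\<close>.\<close>

definition frame :: "nat \<Rightarrow> tile set \<Rightarrow> nat \<Rightarrow> nat \<Rightarrow> nat \<Rightarrow> nat \<Rightarrow> bool" where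
  "frame n D i j h k \<longleftrightarrow> 1 \<le> h \<and> h < i \<and> 1 \<le> j \<and> j < k \<and> k \<le> n \<and> (h, j) \<notin> D \<and> (i, k) \<notin> D \<and>
     (\<forall>r. h < r \<longrightarrow> r \<le> i \<longrightarrow> (r, j) \<in> D) \<and> (\<forall>c. j \<le> c \<longrightarrow> c < k \<longrightarrow> (i, c) \<in> D)"

text \<open>Row \<open>i\<close> is left out because it ends in the bump \<open>(i, k)\<close> and
  is described by \<open>frame\<close>; row \<open>a\<close> is left out because it is meant to hold
  the lowest bump above row \<open>i\<close>.\<close>

definition full_rows :: "tile set \<Rightarrow> nat \<Rightarrow> nat \<Rightarrow> nat \<Rightarrow> nat \<Rightarrow> bool" where
  "full_rows D a i j k \<longleftrightarrow> (\<forall>r c. a < r \<longrightarrow> r < i \<longrightarrow> j \<le> c \<longrightarrow> c \<le> k \<longrightarrow> (r, c) \<in> D)"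

lemma frameD:
  assumes "frame n D i j h k"
  shows "1 \<le> h" "h < i" "1 \<le> j" "j < k" "k \<le> n" "(h, j) \<notin> D" "(i, k) \<notin> D" "(i, j) \<in> D"
    and "\<And>r. h < r \<Longrightarrow> r \<le> i \<Longrightarrow> (r, j) \<in> D" and "\<And>c. j \<le> c \<Longrightarrow> c < k \<Longrightarrow> (i, c) \<in> D"
  using assms unfolding frame_def by auto

lemma frameI:
  assumes "1 \<le> h" "h < i" "1 \<le> j" "j < k" "k \<le> n" "(h, j) \<notin> D" "(i, k) \<notin> D"
    and "\<And>r. h < r \<Longrightarrow> r \<le> i \<Longrightarrow> (r, j) \<in> D" and "\<And>c. j \<le> c \<Longrightarrow> c < k \<Longrightarrow> (i, c) \<in> D"
  shows "frame n D i j h k"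
  using assms unfolding frame_def by auto

lemma full_rowsD: "full_rows D a i j k \<Longrightarrow> a < r \<Longrightarrow> r < i \<Longrightarrow> j \<le> c \<Longrightarrow> c \<le> k \<Longrightarrow> (r, c) \<in> D"
  unfolding full_rows_def by blast

section \<open>Evaluating one step of the recursion\<close>

lemma frame_movable: "frame n D i j h k \<Longrightarrow> movable D i j"
  using frameD[of n D i j h k] by (auto simp: movable_def intro!: bexI[of _ h])

lemma frame_rect_top:
  assumes "frame n D i j h k" shows "rect_top D i j = h"
  unfolding rect_top_def
proof (rule Max_eqI)
  fix y assume "y \<in> {h \<in> {1..<i}. (h, j) \<notin> D}"
  then show "y \<le> h" using frameD(9)[OF assms, of y] by (cases "y \<le> h") auto
qed (use frameD[OF assms] in auto)

lemma frame_rect_right: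
  assumes "frame n D i j h k" shows "rect_right n D i j = k"
  unfolding rect_right_def
proof (rule Min_eqI)
  fix y assume "y \<in> {k \<in> {j + 1..n}. (i, k) \<notin> D}"
  then show "k \<le> y" using frameD(10)[OF assms, of y] by (cases "k \<le> y") auto
qed (use frameD[OF assms] in auto)

lemma frame_bump_row:
  assumes f: "frame n D i j h k" and a: "h \<le> a" "a < i" "full_rows D a i j k"
    and q: "j \<le> q" "q \<le> k" "(a, q) \<notin> D"
  shows "bump_row n D i j = a"
  unfolding bump_row_def frame_rect_top[OF f] frame_rect_right[OF f]
proof (rule Max_eqI)
  fix y assume "y \<in> {p \<in> {h..<i}. \<exists>q\<in>{j..k}. (p, q) \<notin> D}"
  then show "y \<le> a" using full_rowsD[OF a(3), of y] by (cases "y \<le> a") auto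
qed (use a q in auto)

text \<open>One lemma for two rules. For \<open>b < k\<close> the bump in column \<open>b\<close> is
  \<open>(h, b)\<close>; for \<open>b = k\<close> it is \<open>(i, k)\<close>, which explains the
  guard on the condition for row \<open>h\<close>.\<close>

lemma frame_bump_col:
  assumes f: "frame n D i j h k" and full: "full_rows D h i j k"
    and b: "j < b" "b \<le> k" "b < k \<Longrightarrow> (h, b) \<notin> D" "\<And>c. j < c \<Longrightarrow> c < b \<Longrightarrow> (h, c) \<in> D"
  shows "bump_col n D i j = b"
  unfolding bump_col_def frame_rect_top[OF f] frame_rect_right[OF f]
proof (rule Min_eqI)
  fix y assume y: "y \<in> {q \<in> {j<..k}. \<exists>p\<in>{h..i}. (p, q) \<notin> D}"
  show "b \<le> y"
  proof (rule ccontr)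
    assume "\<not> b \<le> y"
    then have "(p, y) \<in> D" if "h \<le> p" "p \<le> i" for p
      using y that b(2) b(4)[of y] full_rowsD[OF full, of p y] frameD(10)[OF f, of y]
      by (cases "p = h"; cases "p = i") auto
    then show False using y by auto
  qed
next
  show "b \<in> {q \<in> {j<..k}. \<exists>p\<in>{h..i}. (p, q) \<notin> D}"
    using b(1,2,3) frameD(2,7)[OF f] by (cases "b = k") (auto intro: bexI[of _ h] bexI[of _ i])
qed auto

text \<open>This and the next two lemmas turn the rules into equivalences over a known frame, so
  that an operator can be evaluated as well as taken apart.\<close>

lemma move_op_ladder:
  assumes f: "frame n D i j h k" and l: "ladder_rect D i j h k"
  shows "move_op n i j D D' \<longleftrightarrow> D' = insert (h, k) (D - {(i, j)})"
proof -
  have full: "full_rows D h i j k"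
    unfolding full_rows_def
  proof (intro allI impI)
    fix r c assume "h < r" "r < i" "j \<le> c" "c \<le> k"
    then show "(r, c) \<in> D" using ladder_rectD(9)[OF l, of r c] by auto
  qed
  have row: "bump_row n D i j = rect_top D i j"
    using frame_bump_row[OF f _ _ full, of j] frameD[OF f] frame_rect_top[OF f] by auto
  have "(h, c) \<in> D" if "j < c" "c < k" for c
    using ladder_rectD(9)[OF l, of h c] that frameD(2)[OF f] by auto
  then have col: "bump_col n D i j = rect_right n D i j"
    using frame_bump_col[OF f full, of k] frameD(4)[OF f] frame_rect_right[OF f] by auto
  have lm: "ladder_move i j D D' \<longleftrightarrow> D' = insert (h, k) (D - {(i, j)})" for D'
    using l ladder_rect_unique[OF l] unfolding ladder_move_def by blast
  show ?thesis
    using move_op.ladder[OF frame_movable[OF f] row col] lm row col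
    by (auto elim: move_op.cases)
qed

lemma move_op_up:
  assumes f: "frame n D i j h k" and a: "h < a" "a < i" "full_rows D a i j k"
    and q: "j \<le> q" "q \<le> k" "(a, q) \<notin> D"
  shows "move_op n i j D D' \<longleftrightarrow> (\<exists>E. move_op n a j D E \<and> move_op n i j E D')"
proof -
  have row: "bump_row n D i j = a" "rect_top D i j = h"
    using frame_bump_row[OF f _ a(2,3) q] a(1) frame_rect_top[OF f] by auto
  show ?thesis
    using move_op.up[OF frame_movable[OF f]] row a(1)
    by (auto elim: move_op.cases)
qed

lemma move_op_right:
  assumes f: "frame n D i j h k" and full: "full_rows D h i j k"
    and b: "j < b" "b < k" "(h, b) \<notin> D" "\<And>c. j < c \<Longrightarrow> c < b \<Longrightarrow> (h, c) \<in> D"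
  shows "move_op n i j D D' \<longleftrightarrow> (\<exists>E. move_op n i b D E \<and> move_op n i j E D')"
proof -
  have row: "bump_row n D i j = rect_top D i j"
    using frame_bump_row[OF f _ _ full, of j] frameD[OF f] frame_rect_top[OF f] by auto
  have col: "bump_col n D i j = b" "rect_right n D i j = k"
    using frame_bump_col[OF f full, of b] b frame_rect_right[OF f] by auto
  show ?thesis
    using move_op.right[OF frame_movable[OF f]] row col b(2)
    by (auto elim: move_op.cases)
qed

lemma move_op_ladder_le: "move_op n i j D D' \<Longrightarrow> ladder_le D D'"
  by (induction rule: move_op.induct) (auto intro: rtranclp_trans)

text \<open>The cases match the rules \<open>up\<close>, \<open>right\<close> and
  \<open>ladder\<close>. In the first the bump is not in column \<open>j\<close>, which has only
  crosses below row \<open>h\<close>. In the last the corner \<open>(h, k)\<close> remains open: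
  only reducedness settles it.\<close>

lemma frame_cases:
  assumes f: "frame n D i j h k"
  obtains (row) a q where "h < a" "a < i" "full_rows D a i j k" "j < q" "q \<le> k" "(a, q) \<notin> D"
  | (col) b where "full_rows D h i j k" "j < b" "b < k" "(h, b) \<notin> D"
      "\<And>c. j < c \<Longrightarrow> c < b \<Longrightarrow> (h, c) \<in> D"
  | (full) "full_rows D h i j k" "\<And>c. j < c \<Longrightarrow> c < k \<Longrightarrow> (h, c) \<in> D"
proof (cases "full_rows D h i j k")
  case True
  show thesis
  proof (cases "\<exists>b. j < b \<and> b < k \<and> (h, b) \<notin> D")
    case ex: True
    define b where "b = (LEAST b. j < b \<and> b < k \<and> (h, b) \<notin> D)"
    have "j < b \<and> b < k \<and> (h, b) \<notin> D" unfolding b_def using ex by (rule LeastI_ex)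
    moreover have "(h, c) \<in> D" if "j < c" "c < b" for c
      using not_less_Least[of c "\<lambda>b. j < b \<and> b < k \<and> (h, b) \<notin> D"] that calculation
      unfolding b_def[symmetric] by auto
    ultimately show thesis using col[OF True] by blast
  next
    case False
    then show thesis using full[OF True] by blast
  qed
next
  case False
  define A where "A = {r. h < r \<and> r < i \<and> (\<exists>c. j \<le> c \<and> c \<le> k \<and> (r, c) \<notin> D)}"
  define a where "a = Max A"
  have fin: "finite A" unfolding A_def by (rule finite_subset[of _ "{..<i}"]) auto
  have "A \<noteq> {}" using False unfolding full_rows_def A_def by auto
  then have "a \<in> A" unfolding a_def using fin Max_in by blast
  then obtain q where q: "h < a" "a < i" "j \<le> q" "q \<le> k" "(a, q) \<notin> D" unfolding A_def by auto
  then have "q \<noteq> j" using frameD(9)[OF f, of a] by auto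
  moreover have "full_rows D a i j k"
    unfolding full_rows_def
  proof (intro allI impI)
    fix r c assume rc: "a < r" "r < i" "j \<le> c" "c \<le> k"
    then have "r \<notin> A" using Max_ge[OF fin, of r] unfolding a_def by auto
    then show "(r, c) \<in> D" using rc q(1) unfolding A_def by auto
  qed
  ultimately show thesis using row[of a q] q by auto
qed

lemma frame_exists:
  assumes w: "w permutes {1..n}" "D \<in> RPD w" and "movable D i j"
  obtains h k where "frame n D i j h k"
proof -
  have ij: "(i, j) \<in> D" "\<exists>h. 1 \<le> h \<and> h < i \<and> (h, j) \<notin> D" using assms(3) by (auto simp: movable_def)
  have pos: "1 \<le> i" "1 \<le> j" "i + j \<le> n" using RPD_pos[OF w(2) ij(1)] RPD_triangle[OF w ij(1)] by auto
  define H where "H = {h. 1 \<le> h \<and> h < i \<and> (h, j) \<notin> D}"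
  define h where "h = Max H"
  have fin: "finite H" unfolding H_def by (rule finite_subset[of _ "{..<i}"]) auto
  have "H \<noteq> {}" using ij(2) unfolding H_def by auto
  then have "h \<in> H" unfolding h_def using fin Max_in by blast
  then have h: "1 \<le> h" "h < i" "(h, j) \<notin> D" unfolding H_def by auto
  \<comment> \<open>Since \<open>i + n > n\<close>, row \<open>i\<close> has a bump in column
    \<open>n\<close>; it bounds \<open>k\<close>.\<close>
  have "(i, n) \<notin> D" using RPD_triangle[OF w, of i n] pos by auto
  then have ex: "\<exists>k. j < k \<and> (i, k) \<notin> D" using pos by (intro exI[of _ n]) auto
  define k where "k = (LEAST k. j < k \<and> (i, k) \<notin> D)"
  have k: "j < k \<and> (i, k) \<notin> D" unfolding k_def using ex by (rule LeastI_ex)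
  have k': "k \<le> n" unfolding k_def using \<open>(i, n) \<notin> D\<close> pos by (intro Least_le) auto
  have "frame n D i j h k"
  proof (rule frameI)
    show "(r, j) \<in> D" if "h < r" "r \<le> i" for r
    proof -
      have "r \<notin> H" using that(1) Max_ge[OF fin, of r] unfolding h_def by auto
      then show ?thesis using that ij(1) h(1) unfolding H_def by (cases "r = i") auto
    qed
    show "(i, c) \<in> D" if "j \<le> c" "c < k" for c
      using that ij(1) not_less_Least[of c "\<lambda>k. j < k \<and> (i, k) \<notin> D"]
      unfolding k_def[symmetric] by (cases "c = j") auto
  qed (use h k k' pos in auto)
  then show thesis by (rule that)
qed

text \<open>If the corner were a cross, the rectangle from the last bump \<open>(h, q)\<close> of
  row \<open>h\<close> to \<open>(i, k)\<close> would be full except for these two corners, and two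
  pipes would cross twice.\<close>

lemma RPD_opposite_corner:
  assumes w: "D \<in> RPD w" and f: "frame n D i j h k" and full: "full_rows D h i j k"
  shows "(h, k) \<notin> D"
proof
  assume hk: "(h, k) \<in> D"
  note F = frameD[OF f]
  define B where "B = {c. j \<le> c \<and> c \<le> k \<and> (h, c) \<notin> D}"
  define q where "q = Max B"
  have fin: "finite B" unfolding B_def by (rule finite_subset[of _ "{..k}"]) auto
  have "j \<in> B" using F unfolding B_def by auto
  then have "q \<in> B" unfolding q_def using fin Max_in by blast
  moreover have "q \<noteq> k" using hk calculation unfolding B_def by auto
  ultimately have qk: "q < k" "j \<le> q" "(h, q) \<notin> D" unfolding B_def by auto
  have row: "(h, c) \<in> D" if "q < c" "c \<le> k" for c
  proof -
    have "c \<notin> B" using that(1) Max_ge[OF fin, of c] unfolding q_def by auto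
    then show ?thesis using that qk(2) unfolding B_def by auto
  qed
  have cell: "(r, c) \<in> D" if "h \<le> r" "r \<le> i" "q \<le> c" "c \<le> k" "(r, c) \<noteq> (h, q)" "(r, c) \<noteq> (i, k)" for r c
    using that row[of c] full_rowsD[OF full, of r c] F(10)[of c] qk(2)
    by (cases "r = h"; cases "r = i") auto
  have "{h..i} \<times> {q..k} - {(h, q), (i, k)} \<subseteq> D"
  proof
    fix x assume x: "x \<in> {h..i} \<times> {q..k} - {(h, q), (i, k)}"
    obtain r c where "x = (r, c)" by fastforce
    then show "x \<in> D" using x cell[of r c] by simp
  qed
  with RPD_no_double_crossing[OF w F(1,2) _ qk(1,3) F(7)] qk(2) F(3) show False by linarith
qed

text \<open>This quadrant contains all tiles that the move operator at \<open>(i, j)\<close> reads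
  or changes.\<close>

abbreviation ne :: "nat \<Rightarrow> nat \<Rightarrow> tile set" where
  "ne i j \<equiv> {..i} \<times> {j..}"

lemma frame_full_ladder:
  assumes f: "frame n D i j h k" and full: "full_rows D h i j k" "\<And>c. j < c \<Longrightarrow> c < k \<Longrightarrow> (h, c) \<in> D"
    and "(h, k) \<notin> D"
  shows "ladder_rect D i j h k"
proof (rule ladder_rectI)
  note F = frameD[OF f]
  show "(r, c) \<in> D" if "h \<le> r" "r \<le> i" "j \<le> c" "c \<le> k" "(r, c) \<notin> {(h, j), (i, k), (h, k)}" for r c
    using that full(2)[of c] full_rowsD[OF full(1), of r c] F(10)[of c]
    by (cases "r = h"; cases "r = i") auto
qed (use frameD[OF f] assms(4) in auto)

text \<open>Rule induction phrased with frames instead of \<open>Max\<close> and \<open>Min\<close>.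
  Membership in \<open>RPD w\<close> is carried along because it provides the frame and the bump in
  the opposite corner.\<close>

lemma move_op_frame_induct [consumes 3, case_names ladder up right]:
  assumes "move_op n i j D D'" "w permutes {1..n}" "D \<in> RPD w"
    and ladder: "\<And>D i j h k. frame n D i j h k \<Longrightarrow> ladder_rect D i j h k \<Longrightarrow>
      P i j D (insert (h, k) (D - {(i, j)}))"
    and up: "\<And>D i j h k a q E D'. \<lbrakk>frame n D i j h k; h < a; a < i; full_rows D a i j k;
      j < q; q \<le> k; (a, q) \<notin> D; D \<in> RPD w; move_op n a j D E; P a j D E; P i j E D'\<rbrakk> \<Longrightarrow> P i j D D'"
    and right: "\<And>D i j h k b E D'. \<lbrakk>frame n D i j h k; full_rows D h i j k; j < b; b < k; (h, b) \<notin> D;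
      \<And>c. j < c \<Longrightarrow> c < b \<Longrightarrow> (h, c) \<in> D; D \<in> RPD w; move_op n i b D E; P i b D E; P i j E D'\<rbrakk> \<Longrightarrow> P i j D D'"
  shows "P i j D D'"
  using assms(1-3)
proof (induction rule: move_op.induct)
  case (ladder D i j D')
  obtain h k where f: "frame n D i j h k" using frame_exists ladder by blast
  note top = frame_rect_top[OF f] frame_rect_right[OF f]
  from f show ?case
  proof (cases rule: frame_cases)
    case (row a q)
    then show ?thesis using frame_bump_row[OF f _ _ row(3), of q] ladder.hyps(2) top by auto
  next
    case (col b)
    then show ?thesis using frame_bump_col[OF f col(1), of b] ladder.hyps(3) top by auto
  next
    case full
    have l: "ladder_rect D i j h k"
      using frame_full_ladder[OF f full] RPD_opposite_corner[OF ladder.prems(2) f full(1)] by blast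
    then have "D' = insert (h, k) (D - {(i, j)})"
      using ladder.hyps(4) ladder_rect_unique[OF l] unfolding ladder_move_def by blast
    then show ?thesis using assms(4)[OF f l] by simp
  qed
next
  case (up D i j E D')
  obtain h k where f: "frame n D i j h k" using frame_exists up by blast
  note top = frame_rect_top[OF f] frame_rect_right[OF f]
  have E: "E \<in> RPD w" using up.hyps(3) up.prems(2) move_op_ladder_le ladder_le_RPD by blast
  have contra: "\<not> full_rows D h i j k"
    using frame_bump_row[OF f _ _, of h j] frameD[OF f] up.hyps(2) top by auto
  from f show ?case
  proof (cases rule: frame_cases)
    case (row a q)
    then have "bump_row n D i j = a" using frame_bump_row[OF f _ _ row(3), of q] by auto
    then show ?thesis using assms(5)[OF f row up.prems(2)] up.hyps(3) up.IH up.prems E by simp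
  qed (use contra in auto)
next
  case (right D i j E D')
  obtain h k where f: "frame n D i j h k" using frame_exists right by blast
  note top = frame_rect_top[OF f] frame_rect_right[OF f]
  have E: "E \<in> RPD w" using right.hyps(4) right.prems(2) move_op_ladder_le ladder_le_RPD by blast
  from f show ?case
  proof (cases rule: frame_cases)
    case (row a q)
    then show ?thesis using frame_bump_row[OF f _ _ row(3), of q] right.hyps(2) top by auto
  next
    case (col b)
    then have "bump_col n D i j = b" using frame_bump_col[OF f col(1), of b] by auto
    then show ?thesis
      using assms(6)[OF f col right.prems(2)] right.hyps(4) right.IH right.prems E by simp
  next
    case full
    then show ?thesis using frame_bump_col[OF f full(1), of k] frameD(4)[OF f] right.hyps(3) top by auto
  qed
qed

section \<open>Locality of the move operators\<close>

lemma Diff_eq_trans: "A \<subseteq> B \<Longrightarrow> E - A = D - A \<Longrightarrow> D' - B = E - B \<Longrightarrow> D' - B = D - B"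
  by blast

lemma Int_eq_patch: "A \<subseteq> B \<Longrightarrow> D \<inter> B = E \<inter> B \<Longrightarrow> D1 - A = D - A \<Longrightarrow> D1 \<inter> B = ((E - A) \<union> (D1 \<inter> A)) \<inter> B"
  by blast

text \<open>The quadrants of the inner tiles \<open>(a, j)\<close> and \<open>(i, b)\<close> are
  contained in that of \<open>(i, j)\<close>, and every branch of the recursion ends with a ladder
  move of the cross at \<open>(i, j)\<close>.\<close>

lemma move_op_diagonal:
  assumes "move_op n i j D D'" "w permutes {1..n}" "D \<in> RPD w"
  shows "(i, j) \<in> D" "(i, j) \<notin> D'" "D' - ne i j = D - ne i j"
proof -
  have "(i, j) \<in> D \<and> (i, j) \<notin> D' \<and> D' - ne i j = D - ne i j"
    using assms
  proof (induction rule: move_op_frame_induct)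
    case (ladder D i j h k)
    then show ?case using ladder_rectD(1-8)[of D i j h k] by auto
  next
    case (up D i j h k a q E D')
    have "ne a j \<subseteq> ne i j" using up.hyps(3) by auto
    then show ?case
      using up.IH frameD(8)[OF up.hyps(1)] Diff_eq_trans[of "ne a j" "ne i j" E D D'] by simp
  next
    case (right D i j h k b E D')
    have "ne i b \<subseteq> ne i j" using right.hyps(3) by auto
    then show ?case
      using right.IH frameD(8)[OF right.hyps(1)] Diff_eq_trans[of "ne i b" "ne i j" E D D'] by simp
  qed
  then show "(i, j) \<in> D" "(i, j) \<notin> D'" "D' - ne i j = D - ne i j" by auto
qed

lemma frame_cong:
  assumes "D \<inter> ne i j = E \<inter> ne i j" "frame n D i j h k"
  shows "frame n E i j h k"
proof -
  have eq: "(r, c) \<in> E \<longleftrightarrow> (r, c) \<in> D" if "r \<le> i" "j \<le> c" for r c using assms(1) that by blast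
  note F = frameD[OF assms(2)]
  show ?thesis by (rule frameI) (use F eq in auto)
qed

text \<open>The recursion inspects only the quadrant. Outside of it \<open>E\<close> is arbitrary,
  so the lemma applies to patched sets that are not yet known to be reduced pipe dreams.\<close>

lemma move_op_local:
  assumes "move_op n i j D D'" "w permutes {1..n}" "D \<in> RPD w" "D \<inter> ne i j = E \<inter> ne i j"
  shows "move_op n i j E ((E - ne i j) \<union> (D' \<inter> ne i j))"
proof -
  \<comment> \<open>The first conjunct locates the changes of the inner move; with it the patched
    set again agrees with the inner value on the larger quadrant.\<close>
  have "D' - ne i j = D - ne i j \<and>
      (\<forall>E. D \<inter> ne i j = E \<inter> ne i j \<longrightarrow> move_op n i j E ((E - ne i j) \<union> (D' \<inter> ne i j)))"
    using assms(1-3)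
  proof (induction rule: move_op_frame_induct)
    case (ladder D i j h k)
    note L = ladder_rectD[OF ladder(2)]
    have "move_op n i j E ((E - ne i j) \<union> (insert (h, k) (D - {(i, j)}) \<inter> ne i j))"
      if E: "D \<inter> ne i j = E \<inter> ne i j" for E
    proof -
      have eq: "(r, c) \<in> E \<longleftrightarrow> (r, c) \<in> D" if "r \<le> i" "j \<le> c" for r c using E that by blast
      have lE: "ladder_rect E i j h k"
        by (rule ladder_rectI) (use L eq in auto)
      have "(E - ne i j) \<union> (insert (h, k) (D - {(i, j)}) \<inter> ne i j) = insert (h, k) (E - {(i, j)})"
        using L(1-4) eq by auto
      then show ?thesis using move_op_ladder[OF frame_cong[OF E ladder(1)] lE] by simp
    qed
    then show ?case using L(1-4) by auto
  next
    case (up D i j h k a q D1 D')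
    have sub: "ne a j \<subseteq> ne i j" using up.hyps(3) by auto
    have "move_op n i j E ((E - ne i j) \<union> (D' \<inter> ne i j))" if E: "D \<inter> ne i j = E \<inter> ne i j" for E
    proof -
      have eq: "(r, c) \<in> E \<longleftrightarrow> (r, c) \<in> D" if "r \<le> i" "j \<le> c" for r c using E that by blast
      let ?E1 = "(E - ne a j) \<union> (D1 \<inter> ne a j)"
      have "D \<inter> ne a j = E \<inter> ne a j" using eq sub by auto
      then have "move_op n a j E ?E1" using up.IH(1) by simp
      moreover have "D1 \<inter> ne i j = ?E1 \<inter> ne i j"
        by (rule Int_eq_patch[OF sub E conjunct1[OF up.IH(1)]])
      then have "move_op n i j ?E1 ((?E1 - ne i j) \<union> (D' \<inter> ne i j))" using up.IH(2) by simp
      moreover have "?E1 - ne i j = E - ne i j" using sub by auto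
      moreover have "full_rows E a i j k" using up.hyps(4) eq unfolding full_rows_def by simp
      moreover have "(a, q) \<notin> E" using up.hyps(3,5,7) eq by simp
      ultimately show ?thesis
        using move_op_up[OF frame_cong[OF E up.hyps(1)] up.hyps(2,3) _ _ up.hyps(6)] up.hyps(5)
        by (metis less_imp_le)
    qed
    then show ?case using Diff_eq_trans[OF sub conjunct1[OF up.IH(1)] conjunct1[OF up.IH(2)]] by simp
  next
    case (right D i j h k b D1 D')
    have sub: "ne i b \<subseteq> ne i j" using right.hyps(3) by auto
    have "move_op n i j E ((E - ne i j) \<union> (D' \<inter> ne i j))" if E: "D \<inter> ne i j = E \<inter> ne i j" for E
    proof -
      have eq: "(r, c) \<in> E \<longleftrightarrow> (r, c) \<in> D" if "r \<le> i" "j \<le> c" for r c using E that by blast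
      let ?E1 = "(E - ne i b) \<union> (D1 \<inter> ne i b)"
      have "D \<inter> ne i b = E \<inter> ne i b" using eq sub by auto
      then have "move_op n i b E ?E1" using right.IH(1) by simp
      moreover have "D1 \<inter> ne i j = ?E1 \<inter> ne i j"
        by (rule Int_eq_patch[OF sub E conjunct1[OF right.IH(1)]])
      then have "move_op n i j ?E1 ((?E1 - ne i j) \<union> (D' \<inter> ne i j))" using right.IH(2) by simp
      moreover have "?E1 - ne i j = E - ne i j" using sub by auto
      moreover have "full_rows E h i j k" using right.hyps(2) eq unfolding full_rows_def by simp
      moreover have "(h, b) \<notin> E" "\<And>c. j < c \<Longrightarrow> c < b \<Longrightarrow> (h, c) \<in> E"
        using right.hyps(3,5,6) frameD(2)[OF right.hyps(1)] eq by simp_all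
      ultimately show ?thesis
        using move_op_right[OF frame_cong[OF E right.hyps(1)] _ right.hyps(3,4)] by metis
    qed
    then show ?case
      using Diff_eq_trans[OF sub conjunct1[OF right.IH(1)] conjunct1[OF right.IH(2)]] by simp
  qed
  then show ?thesis using assms(4) by simp
qed

text \<open>
  The value of the move operator when \<open>a = h\<close>: the crosses of row \<open>i\<close> below the bumps of row \<open>h\<close> move up,
  each to the next bump of row \<open>h\<close>.
\<close>

definition shift :: "tile set \<Rightarrow> nat \<Rightarrow> nat \<Rightarrow> nat \<Rightarrow> nat \<Rightarrow> tile set" where
  "shift D h i j k =
     (D - {(i, c) | c. j \<le> c \<and> c < k \<and> (h, c) \<notin> D}) \<union> {(h, c) | c. j < c \<and> c \<le> k \<and> (h, c) \<notin> D}"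

lemma mem_shift:
  "(r, c) \<in> shift D h i j k \<longleftrightarrow>
     (r, c) \<in> D \<and> \<not> (r = i \<and> j \<le> c \<and> c < k \<and> (h, c) \<notin> D) \<or> r = h \<and> j < c \<and> c \<le> k \<and> (h, c) \<notin> D"
  by (auto simp: shift_def)

text \<open>Induction on the width of the rectangle: rule \<open>right\<close> first shifts the part
  from the next bump \<open>b\<close> of row \<open>h\<close> on. The bump at \<open>(h, k)\<close>
  is assumed explicitly in place of reducedness, so that intermediate values can be evaluated at
  once.\<close>

lemma move_op_shift:
  assumes "frame n D i j h k" "full_rows D h i j k" "(h, k) \<notin> D"
  shows "move_op n i j D D' \<longleftrightarrow> D' = shift D h i j k"
  using assms
proof (induction "k - j" arbitrary: j D' rule: less_induct)
  case less
  note f = less.prems(1) note F = frameD[OF f]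
  from f show ?case
  proof (cases rule: frame_cases)
    case (row a q)
    then show ?thesis using full_rowsD[OF less.prems(2), of a q] by auto
  next
    case full
    note l = frame_full_ladder[OF f full less.prems(3)]
    have "(r, c) \<in> shift D h i j k \<longleftrightarrow> (r, c) \<in> insert (h, k) (D - {(i, j)})" for r c
      unfolding mem_shift
        using F(2,4,6) full(2)[of c] less.prems(3) by (cases "c = j"; cases "c = k") auto
    then have "shift D h i j k = insert (h, k) (D - {(i, j)})" by auto
    then show ?thesis using move_op_ladder[OF f l] by simp
  next
    case (col b)
    have fb: "frame n D i b h k"
    proof (rule frameI)
      show "(r, b) \<in> D" if "h < r" "r \<le> i" for r
        using that full_rowsD[OF col(1), of r b] col F(10)[of b] by (cases "r = i") auto
    qed (use F col in auto)
    have "full_rows D h i b k" using col(1,2) unfolding full_rows_def by auto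
    then have IH: "move_op n i b D E \<longleftrightarrow> E = shift D h i b k" for E
      using less.hyps[of b E] fb less.prems(3) col by auto
    let ?E = "shift D h i b k"
    \<comment> \<open>After the inner move \<open>(i, b)\<close> is a bump while
      \<open>(h, b)\<close> still is one, so the rectangle of \<open>(i, j)\<close> now ends in
      column \<open>b\<close> and is a ladder rectangle.\<close>
    have fE: "frame n ?E i j h b"
    proof (rule frameI)
      show "(r, j) \<in> ?E" if "h < r" "r \<le> i" for r using that F(9)[of r] col(2) by (auto simp: mem_shift)
      show "(i, c) \<in> ?E" if "j \<le> c" "c < b" for c
        using that F(10)[of c] col(3) by (auto simp: mem_shift)
    qed (use F col in \<open>auto simp: mem_shift\<close>)
    have lE: "ladder_rect ?E i j h b"
    proof (rule ladder_rectI)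
      show "(r, c) \<in> ?E" if "h \<le> r" "r \<le> i" "j \<le> c" "c \<le> b" "(r, c) \<notin> {(h, j), (i, b), (h, b)}" for r c
        using that col(5)[of c] full_rowsD[OF col(1), of r c] F(10)[of c] col(3)
        unfolding mem_shift by (cases "r = h"; cases "r = i") auto
    qed (use F col in \<open>auto simp: mem_shift\<close>)
    have "(r, c) \<in> shift D h i j k \<longleftrightarrow> (r, c) \<in> insert (h, b) (?E - {(i, j)})" for r c
      unfolding mem_shift insert_iff Diff_iff prod.inject using F(2,4,6) col(2-4) col(5)[of c]
      by (cases "c = b"; cases "c < b"; cases "c = j"; cases "c < j") auto
    then have "shift D h i j k = insert (h, b) (?E - {(i, j)})" by auto
    then show ?thesis
      using move_op_right[OF f col] IH move_op_ladder[OF fE lE] by simp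
  qed
qed

lemma move_op_outside:
  assumes "move_op n i j D D'" "w permutes {1..n}" "D \<in> RPD w" "i < r \<or> c < j"
  shows "(r, c) \<in> D' \<longleftrightarrow> (r, c) \<in> D"
proof -
  have "(r, c) \<notin> ne i j" using assms(4) by auto
  then show ?thesis using move_op_diagonal(3)[OF assms(1-3)] by (metis DiffD1 DiffI)
qed

text \<open>
  Row \<open>i\<close> of \<open>E\<close> plays the role of row \<open>a\<close> of \<open>D\<close>: the rows of \<open>E\<close> from \<open>a\<close> to \<open>i - 1\<close> are full and thus
  invisible to the move operator at \<open>(i, j)\<close>.
\<close>

definition mirror :: "nat \<Rightarrow> nat \<Rightarrow> nat \<Rightarrow> nat \<Rightarrow> tile set \<Rightarrow> tile set \<Rightarrow> bool" where
  "mirror a i j k D E \<longleftrightarrow> a < i \<and> j < k \<and> (\<forall>c. j \<le> c \<longrightarrow> c < k \<longrightarrow> (a, c) \<in> D \<and> (i, c) \<in> E) \<and>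
     (a, k) \<notin> D \<and> (i, k) \<notin> E \<and> (\<forall>r c. a \<le> r \<longrightarrow> r < i \<longrightarrow> j \<le> c \<longrightarrow> c \<le> k \<longrightarrow> (r, c) \<in> E) \<and>
     (\<forall>r c. r < a \<longrightarrow> j \<le> c \<longrightarrow> ((r, c) \<in> D \<longleftrightarrow> (r, c) \<in> E))"

lemma mirrorD:
  assumes "mirror a i j k D E"
  shows "a < i" "j < k" "(a, k) \<notin> D" "(i, k) \<notin> E"
    and "\<And>c. j \<le> c \<Longrightarrow> c < k \<Longrightarrow> (a, c) \<in> D" "\<And>c. j \<le> c \<Longrightarrow> c < k \<Longrightarrow> (i, c) \<in> E"
    and "\<And>r c. a \<le> r \<Longrightarrow> r < i \<Longrightarrow> j \<le> c \<Longrightarrow> c \<le> k \<Longrightarrow> (r, c) \<in> E"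
    and "\<And>r c. r < a \<Longrightarrow> j \<le> c \<Longrightarrow> (r, c) \<in> D \<longleftrightarrow> (r, c) \<in> E"
  using assms unfolding mirror_def by blast+

lemma mirror_frame:
  assumes m: "mirror a i j k D E" and f: "frame n E i j h k'"
  shows "k' = k" "h < a" "frame n D a j h k"
proof -
  note M = mirrorD[OF m] note F = frameD[OF f]
  show k: "k' = k"
    using F(4,7) F(10)[of k] M(2,4) M(6)[of k'] by (cases k k' rule: linorder_cases) auto
  show h: "h < a" using M(7)[of h j] M(2) F(2,6) by (cases "h < a") auto
  show "frame n D a j h k"
  proof (rule frameI)
    show "(r, j) \<in> D" if "h < r" "r \<le> a" for r
      using that M(2) M(5)[of j] M(8)[of r j] F(9)[of r] M(1) by (cases "r = a") auto
    show "(h, j) \<notin> D" using F(6) M(8)[of h j] h by simp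
  qed (use F M k h in auto)
qed

text \<open>The relation between the values of two mirrored moves. Row \<open>a\<close> of
  \<open>D'\<close> and row \<open>i\<close> of \<open>E'\<close> are no longer full as in
  \<open>mirror\<close>, but have matching bumps; the last two clauses record what the moves leave
  untouched.\<close>

definition mirrored :: "nat \<Rightarrow> nat \<Rightarrow> nat \<Rightarrow> nat \<Rightarrow> tile set \<Rightarrow> tile set \<Rightarrow> tile set \<Rightarrow> tile set \<Rightarrow> bool" where
  "mirrored a i j k D E D' E' \<longleftrightarrow>
    (\<forall>r c. r < a \<longrightarrow> j \<le> c \<longrightarrow> ((r, c) \<in> D' \<longleftrightarrow> (r, c) \<in> E')) \<and>
    (\<forall>c. j \<le> c \<longrightarrow> c < k \<longrightarrow> ((a, c) \<in> D' \<longleftrightarrow> (i, c) \<in> E')) \<and>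
    (\<forall>r c. c < j \<or> a < r \<or> r = a \<and> k \<le> c \<longrightarrow> ((r, c) \<in> D' \<longleftrightarrow> (r, c) \<in> D)) \<and>
    (\<forall>r c. c < j \<or> a \<le> r \<and> r < i \<or> i < r \<or> r = i \<and> k \<le> c \<longrightarrow> ((r, c) \<in> E' \<longleftrightarrow> (r, c) \<in> E))"

lemma mirroredD:
  assumes "mirrored a i j k D E D' E'"
  shows "r < a \<Longrightarrow> j \<le> c \<Longrightarrow> (r, c) \<in> D' \<longleftrightarrow> (r, c) \<in> E'"
    and "j \<le> c \<Longrightarrow> c < k \<Longrightarrow> (a, c) \<in> D' \<longleftrightarrow> (i, c) \<in> E'"
    and "c < j \<or> a < r \<or> r = a \<and> k \<le> c \<Longrightarrow> (r, c) \<in> D' \<longleftrightarrow> (r, c) \<in> D"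
    and "c < j \<or> a \<le> r \<and> r < i \<or> i < r \<or> r = i \<and> k \<le> c \<Longrightarrow> (r, c) \<in> E' \<longleftrightarrow> (r, c) \<in> E"
proof -
  note m = assms[unfolded mirrored_def]
  note 1 = conjunct1[OF m] and m' = conjunct2[OF m]
  note 2 = conjunct1[OF m'] and m'' = conjunct2[OF m']
  show "r < a \<Longrightarrow> j \<le> c \<Longrightarrow> (r, c) \<in> D' \<longleftrightarrow> (r, c) \<in> E'"
    by (rule 1[rule_format])
  show "j \<le> c \<Longrightarrow> c < k \<Longrightarrow> (a, c) \<in> D' \<longleftrightarrow> (i, c) \<in> E'"
    by (rule 2[rule_format])
  show "c < j \<or> a < r \<or> r = a \<and> k \<le> c \<Longrightarrow> (r, c) \<in> D' \<longleftrightarrow> (r, c) \<in> D"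
    by (rule conjunct1[OF m'', rule_format])
  show "c < j \<or> a \<le> r \<and> r < i \<or> i < r \<or> r = i \<and> k \<le> c \<Longrightarrow> (r, c) \<in> E' \<longleftrightarrow> (r, c) \<in> E"
    by (rule conjunct2[OF m'', rule_format])
qed

text \<open>Every step of the recursion at \<open>E\<close> is imitated at \<open>D\<close> with row
  \<open>a\<close> in place of row \<open>i\<close>.\<close>

lemma move_op_mirror:
  assumes "move_op n i j E E'" "w permutes {1..n}" "E \<in> RPD w" "mirror a i j k D E"
  shows "\<exists>D1. move_op n a j D D1 \<and> mirrored a i j k D E D1 E'"
  using assms
proof (induction arbitrary: k D rule: move_op_frame_induct)
  case (ladder E i j h k0)
  note M = mirrorD[OF ladder(3)] note k = mirror_frame[OF ladder(3,1)]
  have l: "ladder_rect E i j h k" using ladder(2) k(1) by simp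
  note L = ladder_rectD[OF l]
  have lD: "ladder_rect D a j h k"
  proof (rule ladder_rectI)
    show "(r, c) \<in> D" if "h \<le> r" "r \<le> a" "j \<le> c" "c \<le> k" "(r, c) \<notin> {(h, j), (a, k), (h, k)}" for r c
      using that L(9)[of r c] M(5)[of c] M(8)[of r c] M(1) by (cases "r = a") auto
    show "(h, j) \<notin> D" "(h, k) \<notin> D" using M(8)[of h] L(4,6,8) k(2) by auto
  qed (use frameD[OF k(3)] in auto)
  have "move_op n a j D (insert (h, k) (D - {(a, j)}))"
    using move_op_ladder[OF k(3) lD] by simp
  moreover have "mirrored a i j k D E (insert (h, k) (D - {(a, j)})) (insert (h, k) (E - {(i, j)}))"
    unfolding mirrored_def using M(1,2,5,6,8) k(2) L(4) by auto
  ultimately show ?case using k(1) by blast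
next
  case (up E i j h k0 a' q' E1 E')
  note M = mirrorD[OF up.prems] note k = mirror_frame[OF up.prems up.hyps(1)]
  have a': "a' < a" using M(7)[of a' q'] up.hyps(3,5,6,7) k(1) by (cases "a' < a") auto
  \<comment> \<open>The inner tile lies above row \<open>a\<close>, where \<open>D\<close> and
    \<open>E\<close> coincide, so locality transfers its move unchanged.\<close>
  let ?D1 = "(D - ne a' j) \<union> (E1 \<inter> ne a' j)"
  have "E \<inter> ne a' j = D \<inter> ne a' j" using M(8) a' by auto
  then have D1: "move_op n a' j D ?D1" using move_op_local[OF up.hyps(9) assms(2) up.hyps(8)] by simp
  have E1: "(r, c) \<in> E1 \<longleftrightarrow> (r, c) \<in> E" if "a' < r \<or> c < j" for r c
    using move_op_outside[OF up.hyps(9) assms(2) up.hyps(8) that] .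
  have "mirror a i j k ?D1 E1"
    unfolding mirror_def
  proof (intro conjI allI impI)
    show "(r, c) \<in> ?D1 \<longleftrightarrow> (r, c) \<in> E1" if "r < a" "j \<le> c" for r c
      using that M(8)[of r c] E1[of r c] by (cases "r \<le> a'") auto
    show "(r, c) \<in> E1" if "a \<le> r" "r < i" "j \<le> c" "c \<le> k" for r c
      using that M(7)[of r c] E1[of r c] a' by auto
    show "(i, c) \<in> E1" if "j \<le> c" "c < k" for c using that M(1) M(6)[of c] E1[of i c] a' by auto
    show "(i, k) \<notin> E1" using M(1,4) E1[of i k] a' by auto
  qed (use M(1-3,5) a' in auto)
  from up.IH(2)[OF this] obtain D'
    where D': "move_op n a j ?D1 D'" "mirrored a i j k ?D1 E1 D' E'" by blast
  have "full_rows D a' a j k"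
    unfolding full_rows_def
  proof (intro allI impI)
    fix r c assume "a' < r" "r < a" "j \<le> c" "c \<le> k"
    then show "(r, c) \<in> D" using M(8)[of r c] full_rowsD[OF up.hyps(4), of r c] M(1) k(1) by simp
  qed
  moreover have "(a', q') \<notin> D" using M(8)[of a' q'] up.hyps(5,7) a' by auto
  ultimately have "move_op n a j D D'"
    using move_op_up[OF k(3) up.hyps(2) a'] up.hyps(5,6) k(1) D1 D'(1) by (metis less_imp_le)
  moreover have "mirrored a i j k D E D' E'"
    unfolding mirrored_def
  proof (intro conjI allI impI)
    show "(r, c) \<in> D' \<longleftrightarrow> (r, c) \<in> D" if "c < j \<or> a < r \<or> r = a \<and> k \<le> c" for r c
    proof -
      have "(r, c) \<in> D' \<longleftrightarrow> (r, c) \<in> ?D1" using mirroredD(3)[OF D'(2) that] .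
      then show ?thesis using that a' by auto
    qed
    show "(r, c) \<in> E' \<longleftrightarrow> (r, c) \<in> E" if "c < j \<or> a \<le> r \<and> r < i \<or> i < r \<or> r = i \<and> k \<le> c" for r c
    proof -
      have "(r, c) \<in> E' \<longleftrightarrow> (r, c) \<in> E1" using mirroredD(4)[OF D'(2) that] .
      moreover have "a' < r \<or> c < j" using that a' M(1) by auto
      ultimately show ?thesis using E1 by blast
    qed
  qed (use mirroredD[OF D'(2)] in blast)+
  ultimately show ?case by blast
next
  case (right E i j h k0 b E1 E')
  note M = mirrorD[OF right.prems] note k = mirror_frame[OF right.prems right.hyps(1)]
  have bk: "j < b" "b < k" using right.hyps(3,4) k(1) by auto
  \<comment> \<open>The inner move at \<open>(i, b)\<close> is mirrored at \<open>(a, b)\<close>.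
    Both leave a bump in column \<open>b\<close>, the right end of the mirrored rows for the second
    move.\<close>
  have "mirror a i b k D E"
    using right.prems bk unfolding mirror_def by auto
  from right.IH(1)[OF this] obtain D1
    where D1: "move_op n a b D D1" "mirrored a i b k D E D1 E1" by blast
  have ib: "(i, b) \<notin> E1" using move_op_diagonal(2)[OF right.hyps(8) assms(2) right.hyps(7)] .
  have "mirror a i j b D1 E1"
    unfolding mirror_def
  proof (intro conjI allI impI)
    show "(a, b) \<notin> D1" using mirroredD(2)[OF D1(2), of b] ib bk by simp
    show "(r, c) \<in> E1" if "a \<le> r" "r < i" "j \<le> c" "c \<le> b" for r c
      using that mirroredD(4)[OF D1(2), of c r] M(7)[of r c] bk by simp
    show "(r, c) \<in> D1 \<longleftrightarrow> (r, c) \<in> E1" if "r < a" "j \<le> c" for r c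
    proof (cases "c < b")
      case True
      then show ?thesis
        using mirroredD(3)[OF D1(2), of c r] mirroredD(4)[OF D1(2), of c r] M(8) that by simp
    next
      case False
      then show ?thesis using mirroredD(1)[OF D1(2), of r c] that by simp
    qed
    show "(a, c) \<in> D1" if "j \<le> c" "c < b" for c
      using that mirroredD(3)[OF D1(2), of c a] M(5)[of c] bk by simp
    show "(i, c) \<in> E1" if "j \<le> c" "c < b" for c
      using that mirroredD(4)[OF D1(2), of c i] M(6)[of c] bk by simp
  qed (use M(1) ib bk in auto)
  from right.IH(2)[OF this] obtain D'
    where D': "move_op n a j D1 D'" "mirrored a i j b D1 E1 D' E'" by blast
  have "full_rows D h a j k"
    unfolding full_rows_def
  proof (intro allI impI)
    fix r c assume "h < r" "r < a" "j \<le> c" "c \<le> k"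
    then show "(r, c) \<in> D" using M(8)[of r c] full_rowsD[OF right.hyps(2), of r c] M(1) k(1) by simp
  qed
  moreover have "(h, b) \<notin> D" "\<And>c. j < c \<Longrightarrow> c < b \<Longrightarrow> (h, c) \<in> D"
    using M(8)[OF k(2)] right.hyps(5,6) bk(1) by simp_all
  ultimately have "move_op n a j D D'"
    using move_op_right[OF k(3) _ bk] D1(1) D'(1) by metis
  moreover have "mirrored a i j k D E D' E'"
    unfolding mirrored_def
  proof (intro conjI allI impI)
    show "(a, c) \<in> D' \<longleftrightarrow> (i, c) \<in> E'" if "j \<le> c" "c < k" for c
    proof (cases "c < b")
      case True
      then show ?thesis using mirroredD(2)[OF D'(2)] that by blast
    next
      case False
      then have "(a, c) \<in> D' \<longleftrightarrow> (a, c) \<in> D1" "(i, c) \<in> E' \<longleftrightarrow> (i, c) \<in> E1"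
        using mirroredD(3)[OF D'(2), of c a] mirroredD(4)[OF D'(2), of c i] by simp_all
      then show ?thesis using mirroredD(2)[OF D1(2), of c] that False by simp
    qed
    show "(r, c) \<in> D' \<longleftrightarrow> (r, c) \<in> D" if "c < j \<or> a < r \<or> r = a \<and> k \<le> c" for r c
    proof -
      have "c < j \<or> a < r \<or> r = a \<and> b \<le> c" "c < b \<or> a < r \<or> r = a \<and> k \<le> c" using that bk by auto
      then have "(r, c) \<in> D' \<longleftrightarrow> (r, c) \<in> D1" "(r, c) \<in> D1 \<longleftrightarrow> (r, c) \<in> D"
        using mirroredD(3)[OF D'(2)] mirroredD(3)[OF D1(2)] by blast+
      then show ?thesis by simp
    qed
    show "(r, c) \<in> E' \<longleftrightarrow> (r, c) \<in> E" if "c < j \<or> a \<le> r \<and> r < i \<or> i < r \<or> r = i \<and> k \<le> c" for r c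
    proof -
      have "c < j \<or> a \<le> r \<and> r < i \<or> i < r \<or> r = i \<and> b \<le> c"
        "c < b \<or> a \<le> r \<and> r < i \<or> i < r \<or> r = i \<and> k \<le> c" using that bk by auto
      then have "(r, c) \<in> E' \<longleftrightarrow> (r, c) \<in> E1" "(r, c) \<in> E1 \<longleftrightarrow> (r, c) \<in> E"
        using mirroredD(4)[OF D'(2)] mirroredD(4)[OF D1(2)] by blast+
      then show ?thesis by simp
    qed
  qed (use mirroredD(1)[OF D'(2)] in blast)
  ultimately show ?case by blast
qed

section \<open>Optimality of the move operators\<close>

abbreviation sw :: "nat \<Rightarrow> nat \<Rightarrow> tile set" where
  "sw i j \<equiv> {i<..} \<times> {..<j}"

lemma sw_closed_sw: "sw_closed (sw i j)"
  by (auto simp: sw_closed_def)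

text \<open>
  The pipe dreams may differ in row \<open>i\<close> to the left of \<open>(i, j)\<close> and in column \<open>j\<close> below it: the induction
  meets such differences when it passes from \<open>(i, j)\<close> to the tiles \<open>(a, j)\<close> and \<open>(i, b)\<close> of the
  recursion. Agreement on \<open>sw i j\<close> cannot be dropped altogether.
\<close>

definition optimal :: "nat \<Rightarrow> tile set \<Rightarrow> nat \<Rightarrow> nat \<Rightarrow> bool" where
  "optimal n D i j \<longleftrightarrow> (\<forall>D2. ladder_le D D2 \<longrightarrow> (i, j) \<in> D \<longrightarrow> (i, j) \<notin> D2 \<longrightarrow>
     D \<inter> sw i j = D2 \<inter> sw i j \<longrightarrow> (\<exists>D'. move_op n i j D D' \<and> ladder_le D' D2))"

section \<open>The operator before and after one ladder move\<close>

lemma ladder_rect_frame: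
  assumes "ladder_rect D i j h k" "k \<le> n"
  shows "frame n D i j h k"
proof (rule frameI)
  note L = ladder_rectD[OF assms(1)]
  show "(r, j) \<in> D" if "h < r" "r \<le> i" for r using L(9)[of r j] L(4) that by auto
  show "(i, c) \<in> D" if "j \<le> c" "c < k" for c using L(9)[of i c] L(2) that by auto
qed (use ladder_rectD[OF assms(1)] assms(2) in auto)

text \<open>The ladder move from \<open>D\<close> to \<open>E\<close> takes \<open>(p, q)\<close> to
  \<open>(u, v)\<close>. In the step lemmas \<open>(i, j)\<close> is the tile of the operator,
  \<open>h\<close> and \<open>k\<close> are the ends of its frame in \<open>D\<close>, and
  \<open>E'\<close> is the value at \<open>E\<close>.\<close>

locale ladder_step =
  fixes n :: nat and w :: "nat \<Rightarrow> nat" and D E :: "tile set" and p q u v :: nat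
  assumes perm: "w permutes {1..n}" and D_RPD: "D \<in> RPD w"
    and rect: "ladder_rect D p q u v" and E_def: "E = insert (u, v) (D - {(p, q)})"
begin

lemmas corners = ladder_rectD(1-8)[OF rect]

lemma bullet: "u \<le> r \<Longrightarrow> r \<le> p \<Longrightarrow> q \<le> c \<Longrightarrow> c \<le> v \<Longrightarrow> (r, c) \<notin> D \<Longrightarrow>
    r = u \<and> c = q \<or> r = p \<and> c = v \<or> r = u \<and> c = v"
  by (rule ladder_rectD(9)[OF rect])

lemma mem_E: "(r, c) \<in> E \<longleftrightarrow> r = u \<and> c = v \<or> (r, c) \<in> D \<and> \<not> (r = p \<and> c = q)"
  by (auto simp: E_def)

lemma D_le_E: "ladder_le D E"
  unfolding E_def by (rule ladder_le_step[OF rect])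

lemma E_RPD: "E \<in> RPD w"
  using ladder_le_RPD[OF D_le_E D_RPD] .

lemma move_op_pq: "move_op n p q D E"
proof -
  \<comment> \<open>The bound comes from \<open>E\<close>, where \<open>(u, v)\<close> is a
    cross.\<close>
  have "v \<le> n" using RPD_triangle[OF perm E_RPD, of u v] by (simp add: mem_E)
  then show ?thesis using move_op_ladder[OF ladder_rect_frame[OF rect] rect] E_def by simp
qed

text \<open>By \<open>far\<close> the ladder rectangle misses the quadrant \<open>ne i j\<close>, so
  neither move sees the other.\<close>

lemma commute:
  assumes mv: "move_op n i j E E1" and far: "v < j \<or> i < u"
  shows "\<exists>D1. move_op n i j D D1 \<and> ladder_le D1 E1"
proof -
  let ?D1 = "(D - ne i j) \<union> (E1 \<inter> ne i j)"
  have "E \<inter> ne i j = D \<inter> ne i j" using far corners(2,4) by (auto simp: mem_E)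
  then have "move_op n i j D ?D1" using move_op_local[OF mv perm E_RPD] by simp
  moreover have mem: "(r, c) \<in> ?D1 \<longleftrightarrow> (r, c) \<in> D" if "i < r \<or> c < j" for r c using that by auto
  have "ladder_rect ?D1 p q u v"
  proof (rule ladder_rectI)
    show "(r, c) \<in> ?D1" if "u \<le> r" "r \<le> p" "q \<le> c" "c \<le> v" "(r, c) \<notin> {(u, q), (p, v), (u, v)}" for r c
      using that bullet[of r c] far mem[of r c] by auto
  qed (use corners far mem in auto)
  then have "ladder_le ?D1 (insert (u, v) (?D1 - {(p, q)}))" by (rule ladder_le_step)
  moreover have "insert (u, v) (?D1 - {(p, q)}) = E1"
  proof (rule set_eqI)
    fix x :: tile
    obtain r c where x: "x = (r, c)" by fastforce
    show "x \<in> insert (u, v) (?D1 - {(p, q)}) \<longleftrightarrow> x \<in> E1"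
    proof (cases "i < r \<or> c < j")
      case True
      then show ?thesis
        using move_op_outside[OF mv perm E_RPD True] mem[OF True] x by (auto simp: mem_E)
    next
      case False
      then show ?thesis using far corners(2,4) x by auto
    qed
  qed
  ultimately show ?thesis by auto
qed

text \<open>The chain from \<open>D\<close> through \<open>E\<close> to \<open>E1\<close> makes
  \<open>E1\<close> an admissible target for optimality at \<open>D\<close>; \<open>out\<close>
  keeps the ladder move away from \<open>sw i j\<close>.\<close>

lemma optimal_step:
  assumes opt: "optimal n D i j" and mv: "move_op n i j E E1" and ij: "(i, j) \<in> D"
    and out: "\<not> (i < p \<and> q < j)"
  shows "\<exists>D1. move_op n i j D D1 \<and> ladder_le D1 E1"
proof -
  have "ladder_le D E1" using D_le_E move_op_ladder_le[OF mv] by (rule rtranclp_trans)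
  moreover have "(i, j) \<notin> E1" using move_op_diagonal(2)[OF mv perm E_RPD] .
  moreover have "(r, c) \<in> D \<longleftrightarrow> (r, c) \<in> E1" if "i < r" "c < j" for r c
    using move_op_outside[OF mv perm E_RPD] that out corners(2,4) by (auto simp: mem_E)
  then have "D \<inter> sw i j = E1 \<inter> sw i j" by auto
  ultimately show ?thesis using opt ij unfolding optimal_def by blast
qed

text \<open>Rule \<open>up\<close> at \<open>D\<close>, with inner tile \<open>(a, j)\<close> and a
  bump \<open>(a, q0)\<close>. The assumption \<open>special\<close> sets aside the position in
  which the ladder rectangle starts in row \<open>i\<close> to the left of \<open>(i, j)\<close> and
  reaches column \<open>j\<close>.\<close>

lemma row_step:
  assumes f: "frame n D i j h k" and a: "h < a" "a < i" "full_rows D a i j k"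
    and q0: "j < q0" "q0 \<le> k" "(a, q0) \<notin> D"
    and ne: "(p, q) \<noteq> (i, j)" and out: "\<not> (i < p \<and> q < j)" and special: "\<not> (p = i \<and> q < j \<and> j \<le> v)"
    and mv: "move_op n i j E E'" and opt: "optimal n D a j"
  shows "\<exists>D1. move_op n a j D D1 \<and> ladder_le D1 E'"
proof -
  note F = frameD[OF f]
  have full: "(r, c) \<in> D" if "a < r" "r < i" "j \<le> c" "c \<le> k" for r c
    using full_rowsD[OF a(3)] that by blast
  have aj: "(a, j) \<in> D" using F(9) a by auto
  consider (A) "(p, q) = (a, j)" | (B) "a < p" "q < j" | (C) "(p, q) \<noteq> (a, j)" "\<not> (a < p \<and> q < j)"
    by auto
  then show ?thesis
  proof cases
    case A
    then show ?thesis using move_op_pq move_op_ladder_le[OF mv] by auto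
  next
    case B
    have far: "v < j \<or> k < v \<and> a < u"
    proof (cases "p = i")
      case True
      then show ?thesis using special B by auto
    next
      case False
      then have "\<not> (j \<le> v \<and> v \<le> k)" using full[of p v] corners(7) B out by auto
      moreover have "a < u" if "k < v"
      proof (rule ccontr)
        assume "\<not> a < u"
        then show False using bullet[of a q0] q0 B that by auto
      qed
      ultimately show ?thesis by auto
    qed
    have eq: "(r, c) \<in> E \<longleftrightarrow> (r, c) \<in> D" if "r \<le> i" "j \<le> c" "c \<le> k" for r c
      using that far B(2) by (auto simp: mem_E)
    have "frame n E i j h k" by (rule frameI) (use F eq in auto)
    moreover have "full_rows E a i j k" using full eq unfolding full_rows_def by auto
    moreover have "(a, q0) \<notin> E" using q0 eq a(2) by auto
    ultimately obtain E1 where E1: "move_op n a j E E1" "move_op n i j E1 E'"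
      using move_op_up[of n E i j h k a q0 E'] a(1,2) q0(1,2) mv by auto
    then show ?thesis
      using commute[OF E1(1)] far move_op_ladder_le[OF E1(2)] by (meson rtranclp_trans)
  next
    case C
    have col: "\<not> (q = j \<and> a < p \<and> p < i)"
    proof
      assume *: "q = j \<and> a < p \<and> p < i"
      then have "k < v" using full[of p v] corners(4,7) by (cases "k < v") auto
      moreover have "u \<le> h" using F(9)[of u] corners(2,6) * by (cases "u \<le> h") auto
      ultimately show False using bullet[of a q0] q0 a * by auto
    qed
    have hj: "(u, v) \<noteq> (h, j)"
    proof
      assume *: "(u, v) = (h, j)"
      then have "i < p" using F(9)[of p] corners(2,7) by (cases "i < p") auto
      then show False using * out corners(4) by auto
    qed
    have ik: "(u, v) \<noteq> (i, k)"
    proof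
      assume *: "(u, v) = (i, k)"
      then have "q < j" using F(10)[of q] corners(4,6) by (cases "q < j") auto
      then show False using * out corners(2) by auto
    qed
    \<comment> \<open>If the ladder move vacates a tile of column \<open>j\<close> between
      \<open>h\<close> and \<open>a\<close>, or of row \<open>i\<close> between \<open>j\<close> and
      \<open>k\<close>, this tile becomes the new top or right end of the frame.\<close>
    define h' where "h' = (if q = j \<and> h < p \<and> p < a then p else h)"
    define k' where "k' = (if p = i \<and> j < q \<and> q < k then q else k)"
    have h': "h \<le> h'" "h' < a" using a(1) by (auto simp: h'_def)
    have k': "j < k'" "k' \<le> k" using F(4) by (auto simp: k'_def)
    have fE: "frame n E i j h' k'"
    proof (rule frameI)
      show "(h', j) \<notin> E" using hj F(6) corners(2) by (auto simp: h'_def mem_E)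
      show "(i, k') \<notin> E" using ik F(7) corners(2) by (auto simp: k'_def mem_E)
      show "(r, j) \<in> E" if "h' < r" "r \<le> i" for r
      proof -
        have "\<not> (r = p \<and> j = q)" using that C(1) ne col by (auto simp: h'_def split: if_splits)
        then show ?thesis using F(9)[of r] that h' by (auto simp: mem_E)
      qed
      show "(i, c) \<in> E" if "j \<le> c" "c < k'" for c
      proof -
        have "\<not> (i = p \<and> c = q)" using that ne k' by (auto simp: k'_def split: if_splits)
        then show ?thesis using F(10)[of c] that k' by (auto simp: mem_E)
      qed
    qed (use F h' k' a in auto)
    \<comment> \<open>If \<open>(a, q0)\<close> is filled or cut off by the new right end, the
      corner \<open>(u, q)\<close> of the ladder rectangle is a bump of row \<open>a\<close> that
      replaces it.\<close>
    have "\<exists>q1. j < q1 \<and> q1 \<le> k' \<and> (a, q1) \<notin> E"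
    proof (cases "p = i \<and> j < q \<and> q < k")
      case True
      then have v: "v = k"
        using F(10)[of v] corners(4,7) bullet[of i k] corners(2) F(7)
          by (cases v k rule: linorder_cases) auto
      have "u \<le> a" using full[of u q] corners(2,6) True by (cases "u \<le> a") auto
      show ?thesis
      proof (cases "u = a")
        case u: True
        then show ?thesis using True corners(4,6) by (intro exI[of _ q]) (auto simp: k'_def mem_E)
      next
        case False
        then have "q0 < q" using bullet[of a q0] \<open>u \<le> a\<close> a(2) q0(2,3) True v by (cases "q0 < q") auto
        then show ?thesis using True False q0 by (intro exI[of _ q0]) (auto simp: k'_def mem_E)
      qed
    next
      case False
      then have k'k: "k' = k" by (auto simp: k'_def)
      show ?thesis
      proof (cases "(u, v) = (a, q0)")
        case True
        then have "j \<le> q" using C corners(2) by auto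
        moreover have "q \<noteq> j" using True corners(6) aj by auto
        ultimately show ?thesis using True corners(4,6) q0 k'k by (intro exI[of _ q]) (auto simp: mem_E)
      next
        case False
        then show ?thesis using q0 k'k by (intro exI[of _ q0]) (auto simp: mem_E)
      qed
    qed
    then obtain q1 where q1: "j < q1" "q1 \<le> k'" "(a, q1) \<notin> E" by blast
    have "\<exists>E1. move_op n a j E E1 \<and> ladder_le E1 E'"
    proof (cases "a < p \<and> p < i \<and> j \<le> q \<and> q \<le> k'")
      case False
      have "full_rows E a i j k'"
        unfolding full_rows_def
      proof (intro allI impI)
        fix r c assume "a < r" "r < i" "j \<le> c" "c \<le> k'"
        then show "(r, c) \<in> E" using False full[of r c] k' by (auto simp: mem_E)
      qed
      from move_op_up[OF fE h'(2) a(2) this less_imp_le[OF q1(1)] q1(2,3)] mv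
      obtain E1 where "move_op n a j E E1" "move_op n i j E1 E'" by blast
      then show ?thesis using move_op_ladder_le by blast
    next
      case True
      \<comment> \<open>The ladder move opens the bump \<open>(p, q)\<close> below row
        \<open>a\<close>, so the recursion at \<open>E\<close> turns to \<open>(p, j)\<close>; the
        recursion for that tile in turn begins with \<open>(a, j)\<close>.\<close>
      then have qj: "j < q" and k'k: "k' = k" and h'h: "h' = h"
        using col by (auto simp: k'_def h'_def order.order_iff_strict)
      have kv: "k < v" using full[of p v] corners(4,7) True by (cases "k < v") auto
      have pq: "(p, q) \<notin> E" using corners(2) by (auto simp: mem_E)
      have fp: "full_rows E p i j k'"
        unfolding full_rows_def
      proof (intro allI impI)
        fix r c assume "p < r" "r < i" "j \<le> c" "c \<le> k'"
        then show "(r, c) \<in> E" using True full[of r c] k' by (auto simp: mem_E)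
      qed
      have "h' < p" using True h'(2) by auto
      from move_op_up[OF fE this _ fp _ _ pq] True mv obtain E2
        where E2: "move_op n p j E E2" "move_op n i j E2 E'" by auto
      have fEp: "frame n E p j h' q"
      proof (rule frameI)
        show "(p, c) \<in> E" if "j \<le> c" "c < q" for c
          using that full[of p c] True k' by (auto simp: mem_E)
        show "q \<le> n" using True k'k F(5) by auto
      qed (use frameD[OF fE] True qj pq \<open>h' < p\<close> in auto)
      have fap: "full_rows E a p j q"
        unfolding full_rows_def
      proof (intro allI impI)
        fix r c assume "a < r" "r < p" "j \<le> c" "c \<le> q"
        then show "(r, c) \<in> E" using True full[of r c] k' by (auto simp: mem_E)
      qed
      have "u \<le> a" using full[of u q] corners(2,6) True k' by (cases "u \<le> a") auto
      have "\<exists>q2. j < q2 \<and> q2 \<le> q \<and> (a, q2) \<notin> E"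
      proof (cases "u = a")
        case u: True
        then show ?thesis using qj corners(4,6) by (intro exI[of _ q]) (auto simp: mem_E)
      next
        case False
        then have "q0 < q" using bullet[of a q0] \<open>u \<le> a\<close> True q0(2,3) kv by (cases "q0 < q") auto
        then show ?thesis using False q0 by (intro exI[of _ q0]) (auto simp: mem_E)
      qed
      then obtain q2 where q2: "j < q2" "q2 \<le> q" "(a, q2) \<notin> E" by blast
      have "a < p" using True by simp
      from move_op_up[OF fEp h'(2) this fap less_imp_le[OF q2(1)] q2(2,3)] E2(1)
      obtain E1 where E1: "move_op n a j E E1" "move_op n p j E1 E2" by blast
      have "ladder_le E1 E'"
        using move_op_ladder_le[OF E1(2)] move_op_ladder_le[OF E2(2)] by (rule rtranclp_trans)
      then show ?thesis using E1(1) by blast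
    qed
    then obtain E1 where E1: "move_op n a j E E1" "ladder_le E1 E'" by blast
    show ?thesis using optimal_step[OF opt E1(1) aj] C(2) E1(2) by (meson rtranclp_trans)
  qed
qed

text \<open>
  Here \<open>(i, q)\<close> moves to \<open>(a, k)\<close> and fills row \<open>a\<close>, so that row \<open>i\<close> of \<open>E\<close> mirrors row \<open>a\<close> of \<open>D\<close>.
\<close>

lemma row_step_special:
  assumes f: "frame n D i j h k" and a: "h < a" "a < i" "full_rows D a i j k"
    and q0: "j < q0" "q0 \<le> k" "(a, q0) \<notin> D"
    and pq: "p = i" "q < j" "j \<le> v"
    and mv: "move_op n i j E E'"
  shows "\<exists>D'. move_op n i j D D' \<and> ladder_le D' E'"
proof -
  note F = frameD[OF f]
  have full: "(r, c) \<in> D" if "a < r" "r < i" "j \<le> c" "c \<le> k" for r c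
    using full_rowsD[OF a(3)] that by blast
  have aj: "(a, j) \<in> D" using F(9) a by auto
  have v: "v = k"
  proof (cases v k rule: linorder_cases)
    case less
    then show ?thesis using F(10)[of v] pq corners(7) by auto
  next
    case greater
    then show ?thesis using bullet[of i k] pq corners(2) F(4,7) by auto
  qed auto
  have "h < u" using bullet[of h j] pq F(2,4,6) v by (cases "h < u") auto
  have "u \<le> a" using full[of u k] corners(2,8) pq v by (cases "u \<le> a") auto
  then have u: "u = a" and q0k: "q0 = k" using bullet[of a q0] a(2) q0 pq v by auto
  have fullE: "(r, c) \<in> E" if "a \<le> r" "r < i" "j \<le> c" "c \<le> k" for r c
    using that bullet[of r c] pq u v by (auto simp: mem_E)
  have "mirror a i j k D E"
    unfolding mirror_def
  proof (intro conjI allI impI)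
    show "(a, c) \<in> D" if "j \<le> c" "c < k" for c
      using that bullet[of a c] pq u v a(2) by auto
    show "(i, c) \<in> E" if "j \<le> c" "c < k" for c using that F(10)[of c] pq by (auto simp: mem_E)
    show "(a, k) \<notin> D" using corners(8) u v by simp
    show "(i, k) \<notin> E" using F(7) a u by (auto simp: mem_E)
    show "(r, c) \<in> D \<longleftrightarrow> (r, c) \<in> E" if "r < a" "j \<le> c" for r c
      using that u pq a(2) by (auto simp: mem_E)
  qed (use a F(4) fullE in auto)
  from move_op_mirror[OF mv perm E_RPD this] obtain D1
    where D1: "move_op n a j D D1" and m: "mirrored a i j k D E D1 E'" by blast
  note m1 = mirroredD(1)[OF m] and m2 = mirroredD(2)[OF m]
    and m3 = mirroredD(3)[OF m] and m4 = mirroredD(4)[OF m]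
  have ajD1: "(a, j) \<notin> D1" using move_op_diagonal(2)[OF D1 perm D_RPD] .
  have fD1: "frame n D1 i j a k"
  proof (rule frameI)
    show "1 \<le> a" "k \<le> n" "1 \<le> j" "j < k" "a < i" using F a by auto
    show "(i, k) \<notin> D1" using F(7) m3[of k i] a(2) by simp
    show "(r, j) \<in> D1" if "a < r" "r \<le> i" for r using that m3[of j r] F(9)[of r] a(1) by simp
    show "(i, c) \<in> D1" if "j \<le> c" "c < k" for c using that m3[of c i] F(10)[of c] a(2) by simp
  qed (fact ajD1)
  have full1: "full_rows D1 a i j k"
    unfolding full_rows_def
  proof (intro allI impI)
    fix r c assume "a < r" "r < i" "j \<le> c" "c \<le> k"
    then show "(r, c) \<in> D1" using m3[of c r] full[of r c] by simp
  qed
  have ak: "(a, k) \<notin> D1" using m3[of k a] corners(8) u v by simp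
  \<comment> \<open>After the shift row \<open>a\<close> is full in columns \<open>j + 1\<close> to
    \<open>k\<close>, and row \<open>i\<close> has the bumps of row \<open>a\<close> of
    \<open>D1\<close>, which are those of row \<open>i\<close> of \<open>E'\<close>. Only the cross
    \<open>(a, j)\<close> is missing, and \<open>(i, q)\<close> moves there.\<close>
  let ?D' = "shift D1 a i j k"
  have "move_op n i j D1 ?D'" using move_op_shift[OF fD1 full1 ak] by simp
  then have "move_op n i j D ?D'"
    using move_op_up[OF f a less_imp_le[OF q0(1)] q0(2,3)] D1 by blast
  moreover have "ladder_rect ?D' i q a j"
  proof (rule ladder_rectI)
    have iq: "(i, q) \<in> D1" using m3[of q i] corners(5) pq a(2) by simp
    show "1 \<le> a" "a < i" "1 \<le> q" "q < j" using F a corners pq by auto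
    show "(i, q) \<in> ?D'" using iq pq by (simp add: mem_shift)
    show "(a, q) \<notin> ?D'" using m3[of q a] corners(6) u pq a(2) by (simp add: mem_shift)
    show "(i, j) \<notin> ?D'" using ajD1 F(4) a(2) by (simp add: mem_shift)
    show "(a, j) \<notin> ?D'" using ajD1 by (simp add: mem_shift)
    show "(r, c) \<in> ?D'" if "a \<le> r" "r \<le> i" "q \<le> c" "c \<le> j" "(r, c) \<notin> {(a, q), (i, j), (a, j)}" for r c
    proof -
      have "(r, c) \<in> D" using bullet[of r c] that u v pq F(4) by auto
      moreover have "c < j \<or> a < r" using that by auto
      then have "(r, c) \<in> D1 \<longleftrightarrow> (r, c) \<in> D" using m3[of c r] by blast
      moreover have "\<not> (r = i \<and> j \<le> c)" using that by auto
      ultimately show ?thesis by (auto simp: mem_shift)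
    qed
  qed
  then have "ladder_le ?D' (insert (a, j) (?D' - {(i, q)}))" by (rule ladder_le_step)
  moreover have "insert (a, j) (?D' - {(i, q)}) = E'"
  proof (rule set_eqI)
    fix x :: tile
    obtain r c where x: "x = (r, c)" by fastforce
    consider "r < a" "j \<le> c" | "r = a" "j \<le> c" "c \<le> k" | "r = i" "j \<le> c" "c < k"
      | "r < a" "c < j" | "r = a" "\<not> (j \<le> c \<and> c \<le> k)" | "r = i" "\<not> (j \<le> c \<and> c < k)" | "a < r" "r \<noteq> i"
      by fastforce
    then have "(r, c) \<in> insert (a, j) (?D' - {(i, q)}) \<longleftrightarrow> (r, c) \<in> E'"
    proof cases
      case 1
      then show ?thesis using m1[of r c] a(2) by (simp add: mem_shift)
    next
      case 2
      then show ?thesis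
        using m4[of c a] fullE[of a c] a(2) by (auto simp: mem_shift)
    next
      case 3
      then show ?thesis using m2[of c] m3[of c i] F(10)[of c] a(2) pq by (simp add: mem_shift)
    next
      case 4
      then show ?thesis using m3[of c r] m4[of c r] a(2) u by (simp add: mem_shift mem_E pq)
    next
      case 5
      then have "(a, c) \<in> E' \<longleftrightarrow> (a, c) \<in> E" "(a, c) \<in> D1 \<longleftrightarrow> (a, c) \<in> D"
        using m3[of c a] m4[of c a] a(2) by auto
      then show ?thesis using 5 a(2) u v pq F(4) by (auto simp: mem_shift mem_E)
    next
      case 6
      then have "(i, c) \<in> E' \<longleftrightarrow> (i, c) \<in> E" "(i, c) \<in> D1 \<longleftrightarrow> (i, c) \<in> D"
        using m3[of c i] m4[of c i] a(2) by auto
      then show ?thesis using 6 a(2) u v pq F(4) by (auto simp: mem_shift mem_E)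
    next
      case 7
      then have "a \<le> r \<and> r < i \<or> i < r" by auto
      with 7 have "(r, c) \<in> E' \<longleftrightarrow> (r, c) \<in> E" "(r, c) \<in> D1 \<longleftrightarrow> (r, c) \<in> D"
        using m3[of c r] m4[of c r] by auto
      then show ?thesis using 7 a(2) u pq by (simp add: mem_shift mem_E)
    qed
    then show "x \<in> insert (a, j) (?D' - {(i, q)}) \<longleftrightarrow> x \<in> E'" unfolding x .
  qed
  ultimately show ?thesis by auto
qed

text \<open>In \<open>E\<close> the tile \<open>(h, v)\<close> is already filled, so the cross at
  \<open>(i, v)\<close> stays, whereas the shift of \<open>D\<close> removes it. The cross
  \<open>(p, j)\<close>, which goes to \<open>(h, v)\<close> in \<open>D\<close>, therefore goes to
  \<open>(i, v)\<close> after the shift.\<close>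

lemma shift_step_below:
  assumes f: "frame n D i j h k" and full: "full_rows D h i j k" and hk: "(h, k) \<notin> D"
    and pq: "i < p" "q = j" "u = h" and v: "v < k"
    and mv: "move_op n i j E E'"
  shows "ladder_le (shift D h i j k) E'"
proof -
  note F = frameD[OF f]
  have eq: "(r, c) \<in> E \<longleftrightarrow> r = h \<and> c = v \<or> (r, c) \<in> D" if "r \<le> i" for r c
    using that pq by (auto simp: mem_E)
  have jv: "j < v" using corners(4) pq by simp
  have "frame n E i j h k" by (rule frameI) (use F eq v jv in auto)
  moreover have "full_rows E h i j k" using full eq unfolding full_rows_def by auto
  moreover have "(h, k) \<notin> E" using hk eq v F(2) by auto
  ultimately have E': "E' = shift E h i j k" using mv move_op_shift by blast
  let ?S = "shift D h i j k"
  have "ladder_rect ?S p j i v"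
  proof (rule ladder_rectI)
    show "(r, c) \<in> ?S" if "i \<le> r" "r \<le> p" "j \<le> c" "c \<le> v" "(r, c) \<notin> {(i, j), (p, v), (i, v)}" for r c
    proof -
      have "(r, c) \<in> D" "r = i \<Longrightarrow> (h, c) \<in> D"
        using bullet[of r c] bullet[of h c] that pq F(2) by auto
      then show ?thesis by (auto simp: mem_shift)
    qed
  qed (use F corners pq v jv in \<open>auto simp: mem_shift\<close>)
  then have "ladder_le ?S (insert (i, v) (?S - {(p, j)}))" by (rule ladder_le_step)
  moreover have "insert (i, v) (?S - {(p, j)}) = E'"
  proof (rule set_eqI)
    fix x :: tile
    obtain r c where x: "x = (r, c)" by fastforce
    have iv: "(i, v) \<in> D" using F(10)[of v] jv v by simp
    show "x \<in> insert (i, v) (?S - {(p, j)}) \<longleftrightarrow> x \<in> E'"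
      unfolding x E' using F(2) pq v jv iv corners(8) by (auto simp: mem_shift mem_E)
  qed
  ultimately show ?thesis by simp
qed

text \<open>The bump \<open>(p, k)\<close> of \<open>E\<close> splits the recursion into two shifts,
  between rows \<open>p\<close> and \<open>h\<close> and between rows \<open>i\<close> and
  \<open>p\<close>. The bumps of row \<open>h\<close> thus arrive in row \<open>i\<close> as under
  the single shift of \<open>D\<close>; what differs is the cross \<open>(p, j)\<close>, which has
  to go to \<open>(h, v)\<close>.\<close>

lemma shift_step_right:
  assumes f: "frame n D i j h k" and full: "full_rows D h i j k" and hk: "(h, k) \<notin> D"
    and pq: "h < p" "p < i" "q = k" "u = h"
    and mv: "move_op n i j E E'"
  shows "ladder_le (shift D h i j k) E'"
proof -
  note F = frameD[OF f]
  have fullD: "(r, c) \<in> D" if "h < r" "r < i" "j \<le> c" "c \<le> k" for r c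
    using full_rowsD[OF full] that by blast
  have eq: "(r, c) \<in> E \<longleftrightarrow> (r, c) \<in> D \<and> \<not> (r = p \<and> c = k)" if "c \<le> k" for r c
    using that pq corners(4) by (auto simp: mem_E)
  have fE: "frame n E i j h k" by (rule frameI) (use F eq pq in auto)
  have fp: "full_rows E p i j k"
    unfolding full_rows_def
  proof (intro allI impI)
    fix r c assume "p < r" "r < i" "j \<le> c" "c \<le> k"
    then show "(r, c) \<in> E" using eq[of c r] fullD[of r c] pq by simp
  qed
  have pk: "(p, k) \<notin> E" using eq by simp
  from move_op_up[OF fE pq(1,2) fp less_imp_le[OF F(4)] order.refl pk] mv
  obtain E1 where E1: "move_op n p j E E1" "move_op n i j E1 E'" by blast
  have fEp: "frame n E p j h k"
    by (rule frameI) (use F eq pq pk fullD in auto)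
  have "full_rows E h p j k"
    unfolding full_rows_def
  proof (intro allI impI)
    fix r c assume "h < r" "r < p" "j \<le> c" "c \<le> k"
    then show "(r, c) \<in> E" using eq[of c r] fullD[of r c] pq by simp
  qed
  moreover have "(h, k) \<notin> E" using eq hk by simp
  ultimately have E1_eq: "E1 = shift E h p j k" using E1(1) move_op_shift[OF fEp] by blast
  have mem1: "(r, c) \<in> E1 \<longleftrightarrow>
      (r, c) \<in> E \<and> \<not> (r = p \<and> j \<le> c \<and> c < k \<and> (h, c) \<notin> D) \<or> r = h \<and> j < c \<and> c \<le> k \<and> (h, c) \<notin> D" for r c
    unfolding E1_eq mem_shift using eq[of c h] pq by auto
  have fE1: "frame n E1 i j p k"
  proof (rule frameI)
    show "(p, j) \<notin> E1" using F(4,6) pq by (simp add: mem1)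
    show "(i, k) \<notin> E1" using F(2,7) eq pq by (simp add: mem1)
    show "(r, j) \<in> E1" if "p < r" "r \<le> i" for r
      using that F(4) F(9)[of r] eq[of j r] pq by (simp add: mem1)
    show "(i, c) \<in> E1" if "j \<le> c" "c < k" for c using that F(10)[of c] eq[of c i] pq by (simp add: mem1)
  qed (use F pq in auto)
  have "full_rows E1 p i j k"
    unfolding full_rows_def
  proof (intro allI impI)
    fix r c assume "p < r" "r < i" "j \<le> c" "c \<le> k"
    then show "(r, c) \<in> E1" using eq[of c r] fullD[of r c] pq by (simp add: mem1)
  qed
  moreover have "(p, k) \<notin> E1" using pk pq by (simp add: mem1)
  ultimately have E': "E' = shift E1 p i j k" using E1(2) move_op_shift[OF fE1] by blast
  let ?S = "shift D h i j k"
  have "ladder_rect ?S p j h v"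
  proof (rule ladder_rectI)
    show "(r, c) \<in> ?S" if "h \<le> r" "r \<le> p" "j \<le> c" "c \<le> v" "(r, c) \<notin> {(h, j), (p, v), (h, v)}" for r c
    proof (cases "c \<le> k")
      case True
      then show ?thesis using that fullD[of r c] pq by (cases "r = h") (auto simp: mem_shift)
    next
      case False
      then have "(r, c) \<in> D" using that bullet[of r c] pq by auto
      then show ?thesis using False pq(2) that by (auto simp: mem_shift)
    qed
  qed (use F corners pq fullD[of p j] in \<open>auto simp: mem_shift\<close>)
  then have "ladder_le ?S (insert (h, v) (?S - {(p, j)}))" by (rule ladder_le_step)
  moreover have "insert (h, v) (?S - {(p, j)}) = E'"
  proof (rule set_eqI)
    fix x :: tile
    obtain r c where x: "x = (r, c)" by fastforce
    have pc: "(p, c) \<in> E1 \<longleftrightarrow> (h, c) \<in> D" if "j \<le> c" "c < k"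
      using that eq[of c p] fullD[of p c] pq by (auto simp: mem1)
    have pk1: "(p, k) \<notin> E1" by fact
    have pcD: "(p, c) \<in> D" if "j \<le> c" "c \<le> k" using that fullD[of p c] pq by simp
    consider "r = p" "j \<le> c" "c \<le> k" | "r = i" "j \<le> c" "c < k"
      | "\<not> (r = p \<and> j \<le> c \<and> c \<le> k)" "\<not> (r = i \<and> j \<le> c \<and> c < k)" by blast
    then have "(r, c) \<in> insert (h, v) (?S - {(p, j)}) \<longleftrightarrow> (r, c) \<in> E'"
    proof cases
      case 1
      then show ?thesis
        unfolding E' mem_shift[of r c E1] using pq pcD pc pk1 F(4,6)
        by (cases "c = j"; cases "c = k") (auto simp: mem_shift)
    next
      case 2
      then show ?thesis
        unfolding E' mem_shift[of r c E1] using pq pc F(4) F(10)[of c] eq[of c i]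
        by (auto simp: mem_shift mem1)
    next
      case 3
      then show ?thesis
        unfolding E' mem_shift[of r c E1] using pq F(4) corners(4) by (auto simp: mem_shift mem1 mem_E)
    qed
    then show "x \<in> insert (h, v) (?S - {(p, j)}) \<longleftrightarrow> x \<in> E'" unfolding x .
  qed
  ultimately show ?thesis by simp
qed

text \<open>Rule \<open>right\<close> at \<open>D\<close>, with inner tile \<open>(i, b)\<close>.
  The second alternative covers two overlaps in which closed forms are compared: a ladder move
  starting in column \<open>j\<close> below \<open>(i, j)\<close>, or in column \<open>k\<close>
  between rows \<open>h\<close> and \<open>i\<close>.\<close>

lemma col_step:
  assumes f: "frame n D i j h k" and full: "full_rows D h i j k" and hk: "(h, k) \<notin> D"
    and b: "j < b" "b < k" "(h, b) \<notin> D" "\<And>c. j < c \<Longrightarrow> c < b \<Longrightarrow> (h, c) \<in> D"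
    and ne: "(p, q) \<noteq> (i, j)" and out: "\<not> (i < p \<and> q < j)"
    and mv: "move_op n i j E E'" and opt: "optimal n D i b"
  shows "(\<exists>D1. move_op n i b D D1 \<and> ladder_le D1 E') \<or> ladder_le (shift D h i j k) E'"
proof -
  note F = frameD[OF f]
  have fullD: "(r, c) \<in> D" if "h < r" "r < i" "j \<le> c" "c \<le> k" for r c
    using full_rowsD[OF full] that by blast
  have ib: "(i, b) \<in> D" using F(10) b by simp
  have inner: "\<exists>E1. move_op n i b E E1 \<and> ladder_le E1 E'"
    if "frame n E i j h k'" "full_rows E h i j k'" "b < k'" "(h, b) \<notin> E"
      "\<And>c. j < c \<Longrightarrow> c < b \<Longrightarrow> (h, c) \<in> E" for k'
  proof -
    from move_op_right[OF that(1,2) b(1) that(3-5)] mv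
    obtain E1 where "move_op n i b E E1" "move_op n i j E1 E'" by blast
    then show ?thesis using move_op_ladder_le by blast
  qed
  \<comment> \<open>A bump of row \<open>h\<close> strictly between \<open>b\<close> and
    \<open>k\<close> may be filled: the recursion at \<open>E\<close> looks for the first bump,
    which remains \<open>(h, b)\<close>.\<close>
  have same: "\<exists>E1. move_op n i b E E1 \<and> ladder_le E1 E'"
    if pq: "\<not> (h \<le> p \<and> p \<le> i \<and> j \<le> q \<and> q \<le> k)"
      and uv: "h \<le> u \<Longrightarrow> u \<le> i \<Longrightarrow> j \<le> v \<Longrightarrow> v \<le> k \<Longrightarrow> u = h \<and> b < v \<and> v < k"
  proof (rule inner)
    have eq: "(r, c) \<in> E \<longleftrightarrow> (r, c) \<in> D"
      if "h \<le> r" "r \<le> i" "j \<le> c" "c \<le> k" "r = h \<Longrightarrow> c \<le> b \<or> c = k" for r c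
      using that pq uv by (fastforce simp: mem_E)
    show "frame n E i j h k"
    proof (rule frameI)
      show "(h, j) \<notin> E" using eq[of h j] F(2,4,6) b(1) by simp
      show "(i, k) \<notin> E" using eq[of i k] F(2,4,7) by simp
      show "(r, j) \<in> E" if "h < r" "r \<le> i" for r using that eq[of r j] F(4) F(9)[of r] by simp
      show "(i, c) \<in> E" if "j \<le> c" "c < k" for c using that eq[of i c] F(2) F(10)[of c] by simp
    qed (use F in auto)
    show "full_rows E h i j k"
      unfolding full_rows_def
    proof (intro allI impI)
      fix r c assume "h < r" "r < i" "j \<le> c" "c \<le> k"
      then show "(r, c) \<in> E" using eq[of r c] fullD[of r c] by simp
    qed
    show "(h, b) \<notin> E" using eq[of h b] F(2) b by simp
    show "(h, c) \<in> E" if "j < c" "c < b" for c using that eq[of h c] F(2) b by simp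
  qed (use b in auto)
  consider (A) "(p, q) = (i, b)" | (B) "p = i" "q < j" | (C) "i < p" "q = j"
    | (D) "i < p" "j < q" "q < b"
    | (E) "i < p" "q = b" | (other) "\<not> (i < p \<and> q \<le> b)" "\<not> (p = i \<and> q < j)" "(p, q) \<noteq> (i, b)"
    using out by force
  then show ?thesis
  proof cases
    case A
    then show ?thesis using move_op_pq move_op_ladder_le[OF mv] by auto
  next
    case B
    have vj: "v < j"
    proof (rule ccontr)
      assume "\<not> v < j"
      then have "v = k"
        using F(10)[of v] corners(7) B bullet[of i k] corners(2) F(4,7)
          by (cases v k rule: linorder_cases) auto
      then have "u \<le> h" using fullD[of u k] corners(2,8) B F(4) by (cases "u \<le> h") auto
      then show False using bullet[of h j] F(2,4,6) B \<open>v = k\<close> by auto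
    qed
    from same obtain E1 where E1: "move_op n i b E E1" "ladder_le E1 E'" using B vj by auto
    then show ?thesis using commute[OF E1(1)] vj b(1) by (meson rtranclp_trans less_trans)
  next
    case C
    show ?thesis
    proof (cases "i < u")
      case True
      from same obtain E1 where E1: "move_op n i b E E1" "ladder_le E1 E'" using C True by auto
      then show ?thesis using commute[OF E1(1)] True by (meson rtranclp_trans)
    next
      case False
      have "u \<le> h" using F(9)[of u] corners(6) C False by (cases "u \<le> h") auto
      then have u: "u = h" using bullet[of h j] F(2,6) C corners(4) by auto
      have vk: "v < k" using bullet[of i k] F(2,4,7) u C by (cases "v < k") auto
      show ?thesis using shift_step_below[OF f full hk C(1,2) u vk mv] by blast
    qed
  next
    case D
    \<comment> \<open>The ladder rectangle either stays below row \<open>i\<close>, or rises above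
      row \<open>h\<close> and then has to end before column \<open>b\<close>, since
      \<open>(h, b)\<close> cannot lie inside it.\<close>
    have far: "i < u \<or> u < h \<and> v < b"
    proof (rule disjCI)
      assume *: "\<not> (u < h \<and> v < b)"
      show "i < u"
      proof (rule ccontr)
        assume "\<not> i < u"
        then have "u \<le> h"
          using F(10)[of q] fullD[of u q] corners(6) D b(2) by (cases "u = i"; cases "u \<le> h") auto
        then have "u < h" using b(4)[of q] corners(6) D by (cases "u = h") auto
        then show False using * bullet[of h b] b(3) D F(2) by auto
      qed
    qed
    from same obtain E1 where E1: "move_op n i b E E1" "ladder_le E1 E'" using D far by auto
    then show ?thesis using commute[OF E1(1)] far by (meson rtranclp_trans)
  next
    case E
    have "u = h \<and> v < k" if "h \<le> u" "u \<le> i"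
    proof -
      have "u = h"
        using ib fullD[of u b] corners(6) E b(1,2) that by (cases "u = i"; cases "u = h") auto
      moreover have "v < k"
        using bullet[of i k] F(7) E b(2) that calculation F(2) by (cases "v < k") auto
      ultimately show ?thesis by simp
    qed
    with same obtain E1 where E1: "move_op n i b E E1" "ladder_le E1 E'" using E corners(4) by auto
    then show ?thesis using optimal_step[OF opt E1(1) ib] E by (meson rtranclp_trans less_irrefl)
  next
    case other
    have piq: "b < q" if "p = i" "q < k"
    proof (rule ccontr)
      assume "\<not> b < q"
      then have q: "j < q" "q < b" using other ne that by auto
      have vk: "k \<le> v" using F(10)[of v] corners(4,7) that q by (cases "k \<le> v") auto
      have "u \<le> h" using fullD[of u q] corners(2,6) that q by (cases "u \<le> h") auto
      then have "u < h" using b(4)[of q] corners(6) q by (cases "u = h") auto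
      then show False using bullet[of h b] b(2,3) q vk that F(2) by auto
    qed
    have hj: "(u, v) \<noteq> (h, j)"
    proof
      assume *: "(u, v) = (h, j)"
      then have "i < p" using F(9)[of p] corners(2,7) by (cases "i < p") auto
      then show False using * out corners(4) by auto
    qed
    have ik: "(u, v) \<noteq> (i, k)"
    proof
      assume *: "(u, v) = (i, k)"
      then have "q < j" using F(10)[of q] corners(4,6) by (cases "q < j") auto
      then show False using * out corners(2) by auto
    qed
    have hb: "(u, v) \<noteq> (h, b)"
    proof
      assume *: "(u, v) = (h, b)"
      then have "i < p"
        using ib fullD[of p b] corners(2,7) b(1,2) by (cases "p = i"; cases "i < p") auto
      then show False using * other corners(4) by auto
    qed
    have col: "\<not> (q = j \<and> h < p \<and> p < i)"
    proof
      assume *: "q = j \<and> h < p \<and> p < i"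
      then have "k < v" using fullD[of p v] corners(4,7) by (cases "k < v") auto
      moreover have "u \<le> h" using F(9)[of u] corners(2,6) * by (cases "u \<le> h") auto
      ultimately show False using bullet[of h b] b * by auto
    qed
    define k' where "k' = (if p = i \<and> j < q \<and> q < k then q else k)"
    have k': "b < k'" "k' \<le> k" using b(2) piq by (auto simp: k'_def)
    have fE: "frame n E i j h k'"
    proof (rule frameI)
      show "(h, j) \<notin> E" using hj F(6) by (auto simp: mem_E)
      show "(i, k') \<notin> E" using ik F(7) corners(2) by (auto simp: k'_def mem_E)
      show "(r, j) \<in> E" if "h < r" "r \<le> i" for r
      proof -
        have "\<not> (r = p \<and> j = q)" using that ne col by auto
        then show ?thesis using F(9)[of r] that by (auto simp: mem_E)
      qed
      show "(i, c) \<in> E" if "j \<le> c" "c < k'" for c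
      proof -
        have "\<not> (i = p \<and> c = q)" using that ne k' by (auto simp: k'_def split: if_splits)
        then show ?thesis using F(10)[of c] that k' by (auto simp: mem_E)
      qed
    qed (use F k' b in auto)
    have hbE: "(h, b) \<notin> E" using hb b(3) by (auto simp: mem_E)
    show ?thesis
    proof (cases "h < p \<and> p < i \<and> j \<le> q \<and> q \<le> k")
      case True
      \<comment> \<open>A ladder move starting inside the full rows has to leave them to the right
        and at the top, so its rectangle contains the bump \<open>(h, k)\<close>, which can only be
        the corner \<open>(u, q)\<close>.\<close>
      have kv: "k < v" using fullD[of p v] corners(4,7) True by (cases "k < v") auto
      have "u \<le> h" using fullD[of u q] corners(2,6) True by (cases "u \<le> h") auto
      then have "u = h" "q = k" using bullet[of h k] hk True kv by auto
      then show ?thesis using shift_step_right[OF f full hk _ _ _ _ mv] True by auto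
    next
      case inside: False
      have fullE: "full_rows E h i j k'"
        unfolding full_rows_def
      proof (intro allI impI)
        fix r c assume "h < r" "r < i" "j \<le> c" "c \<le> k'"
        then show "(r, c) \<in> E" using inside fullD[of r c] k' by (auto simp: mem_E)
      qed
      have "\<exists>E1. move_op n i b E E1 \<and> ladder_le E1 E'"
      proof (cases "p = h \<and> j < q \<and> q < b")
        case False
        show ?thesis
        proof (rule inner[OF fE fullE k'(1) hbE])
          show "(h, c) \<in> E" if "j < c" "c < b" for c using that False b(4)[of c] by (auto simp: mem_E)
        qed
      next
        case True
        \<comment> \<open>The vacated tile \<open>(h, q)\<close> comes before \<open>(h, b)\<close>,
          so the recursion at \<open>E\<close> starts with \<open>(i, q)\<close>, whose own
          recursion starts with \<open>(i, b)\<close>.\<close>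
        then have k'k: "k' = k" using F(2) by (simp add: k'_def)
        have hq: "(h, q) \<notin> E" using True corners(2) by (auto simp: mem_E)
        have "(h, c) \<in> E" if "j < c" "c < q" for c using that True b(4)[of c] by (auto simp: mem_E)
        from move_op_right[OF fE fullE _ _ hq this] True k' mv obtain E2
          where E2: "move_op n i q E E2" "move_op n i j E2 E'" by auto
        have fEq: "frame n E i q h k"
        proof (rule frameI)
          show "(r, q) \<in> E" if "h < r" "r \<le> i" for r
            using that True fullD[of r q] F(10)[of q] b(2) by (cases "r = i") (auto simp: mem_E)
        qed (use frameD[OF fE] F True k' k'k hq b in auto)
        have "full_rows E h i q k" using fullE True unfolding full_rows_def k'k by auto
        moreover have "(h, c) \<in> E" if "q < c" "c < b" for c
          using that True b(4)[of c] by (auto simp: mem_E)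
        ultimately obtain E1 where E1: "move_op n i b E E1" "move_op n i q E1 E2"
          using move_op_right[OF fEq _ _ b(2) hbE] True E2(1) by blast
        have "ladder_le E1 E'"
          using move_op_ladder_le[OF E1(2)] move_op_ladder_le[OF E2(2)] by (rule rtranclp_trans)
        then show ?thesis using E1(1) by blast
      qed
      then obtain E1 where E1: "move_op n i b E E1" "ladder_le E1 E'" by blast
      show ?thesis
        using optimal_step[OF opt E1(1) ib] other(1) E1(2) by (meson rtranclp_trans less_imp_le)
    qed
  qed
qed

text \<open>Rule \<open>ladder\<close> at \<open>D\<close>: there is no inner tile, and the two
  values are compared directly. Apart from two overlaps, the ladder moves of \<open>(i, j)\<close>
  and \<open>(p, q)\<close> leave each other's rectangle intact and commute.\<close>

lemma full_step:
  assumes f: "frame n D i j h k" and l: "ladder_rect D i j h k"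
    and ne: "(p, q) \<noteq> (i, j)" and out: "\<not> (i < p \<and> q < j)"
    and mv: "move_op n i j E E'"
  shows "ladder_le (insert (h, k) (D - {(i, j)})) E'"
proof -
  note F = frameD[OF f]
  have hk: "(h, k) \<notin> D" using ladder_rectD(8)[OF l] .
  have inside: "(r, c) \<in> D"
    if "h \<le> r" "r \<le> i" "j \<le> c" "c \<le> k" "\<not> (r = h \<and> (c = j \<or> c = k))" "\<not> (r = i \<and> c = k)" for r c
    using ladder_rectD(9)[OF l, of r c] that by blast
  have full: "full_rows D h i j k"
    unfolding full_rows_def using inside by auto
  have G: "insert (h, k) (D - {(i, j)}) = shift D h i j k"
    using move_op_shift[OF f full hk] move_op_ladder[OF f l] by blast
  show ?thesis
  proof (cases "h < p \<and> p < i \<and> q = k \<and> u = h")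
    case True
    then show ?thesis using shift_step_right[OF f full hk _ _ _ _ mv] G by simp
  next
    case nsc: False
    show ?thesis
    proof (cases "p = h \<and> v = k \<and> j < q")
      case True
      \<comment> \<open>Since \<open>(h, q)\<close> is vacated, two crosses of row \<open>i\<close>
        move up in \<open>E\<close>: \<open>(i, j)\<close> to \<open>(h, q)\<close> and
        \<open>(i, q)\<close> to \<open>(h, k)\<close>. From \<open>D\<close> the same set is
        reached by moving \<open>(i, j)\<close> to \<open>(h, k)\<close> and then
        \<open>(i, q)\<close> to \<open>(u, k)\<close>.\<close>
      then have qk: "q < k" using corners(4) by simp
      have eq: "(r, c) \<in> E \<longleftrightarrow> (r, c) \<in> D \<and> \<not> (r = h \<and> c = q)" if "h \<le> r" for r c
        using that True corners(2) by (auto simp: mem_E)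
      have "frame n E i j h k" by (rule frameI) (use F eq True in auto)
      moreover have "full_rows E h i j k" using full eq unfolding full_rows_def by auto
      moreover have "(h, k) \<notin> E" using hk eq by simp
      ultimately have E': "E' = shift E h i j k" using mv move_op_shift by blast
      let ?G = "insert (h, k) (D - {(i, j)})"
      have "ladder_rect ?G i q u k"
      proof (rule ladder_rectI)
        show "(r, c) \<in> ?G"
          if "u \<le> r" "r \<le> i" "q \<le> c" "c \<le> k" "(r, c) \<notin> {(u, q), (i, k), (u, k)}" for r c
        proof (cases "r \<le> h")
          case True': True
          then show ?thesis using that bullet[of r c] True F(2) by auto
        next
          case False
          then show ?thesis using that inside[of r c] True by auto
        qed
      qed (use F corners True qk inside[of i q] in auto)
      then have "ladder_le ?G (insert (u, k) (?G - {(i, q)}))" by (rule ladder_le_step)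
      moreover have "insert (u, k) (?G - {(i, q)}) = E'"
      proof (rule set_eqI)
        fix x :: tile
        obtain r c where x: "x = (r, c)" by fastforce
        have hc: "(h, c) \<in> D" if "j < c" "c < k" for c using inside[of h c] that F(2) by auto
        have hE: "(h, c) \<in> E \<longleftrightarrow> c \<noteq> q" if "j < c" "c < k" for c using eq[of h c] hc[of c] that by auto
        have hE': "(h, j) \<notin> E" "(h, k) \<notin> E" using eq F(6) hk by auto
        consider "r = i" "j \<le> c" "c < k" | "r = h" "j < c" "c \<le> k"
          | "\<not> (r = i \<and> j \<le> c \<and> c < k)" "\<not> (r = h \<and> j < c \<and> c \<le> k)" by blast
        then have "(r, c) \<in> insert (u, k) (?G - {(i, q)}) \<longleftrightarrow> (r, c) \<in> E'"
        proof cases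
          case 1
          then show ?thesis
            unfolding E' mem_shift using hE[of c] hE' eq[of i c] F(2) F(10)[of c] True
            by (cases "c = j") auto
        next
          case 2
          then show ?thesis
            unfolding E' mem_shift using hE[of c] hE' hc[of c] eq[of h c] F(2) True corners(2)
            by (cases "c = k") auto
        next
          case 3
          then show ?thesis
            unfolding E' mem_shift using F(2,4) True qk by (auto simp: mem_E)
        qed
        then show "x \<in> insert (u, k) (?G - {(i, q)}) \<longleftrightarrow> x \<in> E'" unfolding x .
      qed
      ultimately show ?thesis by simp
    next
      case nsr: False
      have pi: "v < j" if "p = i" "q < j"
      proof (rule ccontr)
        assume "\<not> v < j"
        then have "v = k"
          using F(10)[of v] corners(7) that bullet[of i k] corners(2) F(4,7)
            by (cases v k rule: linorder_cases) auto
        then have "u \<le> h" using inside[of u k] corners(2,8) that F(4) by (cases "u \<le> h") auto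
        then show False using bullet[of h j] F(2,4,6) that \<open>v = k\<close> by auto
      qed
      have below: "i < u" if "i < p" "q = j"
      proof (rule ccontr)
        assume "\<not> i < u"
        then have "u \<le> h" using F(9)[of u] corners(6) that by (cases "u \<le> h") auto
        then have "u = h" using bullet[of h j] F(2,6) that corners(4) by auto
        then have "k \<le> v" using inside[of h v] corners(4,8) that F(2) by (cases "k \<le> v") auto
        then show False using bullet[of i k] F(2,4,7) \<open>u = h\<close> that by auto
      qed
      have hj: "(u, v) \<noteq> (h, j)"
      proof
        assume *: "(u, v) = (h, j)"
        then have "i < p" using F(9)[of p] corners(2,7) by (cases "i < p") auto
        then show False using * out corners(4) by auto
      qed
      have ik: "(u, v) \<noteq> (i, k)"
      proof
        assume *: "(u, v) = (i, k)"
        then have "q < j" using F(10)[of q] corners(4,6) by (cases "q < j") auto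
        then show False using * out corners(2) by auto
      qed
      have uvhk: "(u, v) \<noteq> (h, k)"
      proof
        assume *: "(u, v) = (h, k)"
        then have "i \<le> p" using inside[of p k] corners(2,7) F(4) by (cases "i \<le> p") auto
        moreover have "q \<le> j" using inside[of h q] corners(4,6) * F(2) by (cases "q \<le> j") auto
        moreover have "i < p \<Longrightarrow> q = j \<Longrightarrow> False" using below * F(2) by auto
        moreover have "p = i \<Longrightarrow> q < j \<Longrightarrow> False" using pi * F(4) by auto
        ultimately show False using ne out by force
      qed
      have pq: "\<not> (h \<le> p \<and> p \<le> i \<and> j \<le> q \<and> q \<le> k)"
      proof
        assume *: "h \<le> p \<and> p \<le> i \<and> j \<le> q \<and> q \<le> k"
        consider "p = i" | "p = h" | "h < p" "p < i" using * by force
        then show False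
        proof cases
          case 1
          then have q: "j < q" "q < k" using * ne corners(5) F(7) by (auto simp: order.order_iff_strict)
          have vk: "v = k"
            using F(10)[of v] corners(2,4,7) bullet[of i k] F(7) q 1
              by (cases v k rule: linorder_cases) auto
          have "u < h" using inside[of u q] corners(2,6) q 1 by (cases "u < h") auto
          then show False using bullet[of h k] hk vk q 1 F(2) by auto
        next
          case 2
          then have q: "j < q" "q < k" using * corners(5) F(6) hk by (auto simp: order.order_iff_strict)
          have "k \<le> v" using inside[of h v] corners(4,7) q 2 F(2) by (cases "k \<le> v") auto
          moreover have "v \<noteq> k" using nsr 2 q by auto
          ultimately show False using bullet[of h k] hk q 2 corners(2) by auto
        next
          case 3
          then have kv: "k < v" using inside[of p v] corners(4,7) * by (cases "k < v") auto
          have "u \<le> h" using inside[of u q] corners(2,6) * 3 by (cases "u \<le> h") auto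
          then show False using bullet[of h k] hk 3 kv * nsc by auto
        qed
      qed
      have lE: "ladder_rect E i j h k"
      proof (rule ladder_rectI)
        show "(r, c) \<in> E" if "h \<le> r" "r \<le> i" "j \<le> c" "c \<le> k" "(r, c) \<notin> {(h, j), (i, k), (h, k)}" for r c
        proof -
          have "(r, c) \<in> D" using inside[of r c] that by auto
          moreover have "\<not> (r = p \<and> c = q)" using pq that by auto
          ultimately show ?thesis by (simp add: mem_E)
        qed
        show "(i, j) \<in> E" using F(8) ne by (auto simp: mem_E)
        show "(h, j) \<notin> E" "(i, k) \<notin> E" "(h, k) \<notin> E" using hj ik uvhk F(6,7) hk by (auto simp: mem_E)
      qed (use F in auto)
      then have E': "E' = insert (h, k) (E - {(i, j)})"
        using move_op_ladder[OF ladder_rect_frame[OF lE F(5)] lE] mv by simp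
      let ?G = "insert (h, k) (D - {(i, j)})"
      have "ladder_rect ?G p q u v"
      proof (rule ladder_rectI)
        show "(u, q) \<notin> ?G"
        proof -
          have "(u, q) \<noteq> (h, k)"
          proof
            assume *: "(u, q) = (h, k)"
            then have "i \<le> p" using nsc corners(2) by auto
            then show False using bullet[of i k] F(2,7) * corners(4,5) by (cases "p = i") auto
          qed
          then show ?thesis using corners(6) by auto
        qed
        show "(p, v) \<notin> ?G"
        proof -
          have "(p, v) \<noteq> (h, k)"
          proof
            assume *: "(p, v) = (h, k)"
            then have "q \<le> j" using nsr by auto
            then show False using bullet[of h j] F(4,6) corners(2,5) * by (cases "q = j") auto
          qed
          then show ?thesis using corners(7) by auto
        qed
        show "(u, v) \<notin> ?G" using uvhk corners(8) by auto
        show "(p, q) \<in> ?G" using corners(5) ne by auto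
        show "(r, c) \<in> ?G"
          if "u \<le> r" "r \<le> p" "q \<le> c" "c \<le> v" "(r, c) \<notin> {(u, q), (p, v), (u, v)}" for r c
        proof -
          have "(r, c) \<in> D" using bullet[of r c] that by auto
          moreover have "(r, c) \<noteq> (i, j)"
          proof
            assume *: "(r, c) = (i, j)"
            then have "i \<le> p" "q \<le> j" using that by auto
            then consider "i < p" "q = j" | "p = i" "q < j" using ne out by force
            then show False using below pi that * by cases auto
          qed
          ultimately show ?thesis by auto
        qed
      qed (use corners in auto)
      then have "ladder_le ?G (insert (u, v) (?G - {(p, q)}))" by (rule ladder_le_step)
      moreover have "insert (u, v) (?G - {(p, q)}) = E'"
      proof -
        have "(u, v) \<noteq> (i, j)" using corners(8) F(8) by auto
        moreover have "(p, q) \<noteq> (h, k)" using corners(5) hk by auto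
        ultimately show ?thesis unfolding E' E_def by auto
      qed
      ultimately show ?thesis by simp
    qed
  qed
qed

end

section \<open>The double induction for optimality\<close>

lemma ladder_le_row_sum_less:
  assumes "ladder_le D E" "finite D" "D \<noteq> E"
  shows "row_sum UNIV E < row_sum UNIV D"
  using assms(1)
proof (cases rule: converse_rtranclpE)
  case (step F)
  have sw: "sw_closed UNIV" by (simp add: sw_closed_def)
  obtain p q u v where r: "ladder_rect D p q u v" "F = insert (u, v) (D - {(p, q)})"
    using step(1) by (auto simp: ladder_move_def)
  have "row_sum UNIV F < row_sum UNIV D" using row_sum_ladder(2)[OF assms(2) sw r(1)] r(2) by simp
  moreover have "row_sum UNIV E \<le> row_sum UNIV F"
    using row_sum_ladder_le[OF step(2) _ sw] assms(2) r(2) by simp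
  ultimately show ?thesis by simp
qed (use assms(3) in simp)

lemma move_op_movable: "move_op n i j D D' \<Longrightarrow> movable D i j"
  by (auto elim: move_op.cases)

text \<open>The outer induction on the row sum supplies optimality at \<open>E\<close> and at the
  inner value \<open>D1\<close>. The inner one, with \<open>D\<close> fixed, supplies the tiles
  \<open>(a, j)\<close> with \<open>a < i\<close> and \<open>(i, b)\<close> with
  \<open>j < b < k \<le> n\<close>, which have smaller \<open>i + (n - j)\<close>.\<close>

theorem RPD_optimal:
  assumes w: "w permutes {1..n}" and "D \<in> RPD w"
  shows "optimal n D i j"
  using assms(2)
proof (induction "row_sum UNIV D" arbitrary: D i j rule: less_induct)
  case outer: (less D i j)
  note D = outer.prems
  show ?case
  proof (induction "i + (n - j)" arbitrary: i j rule: less_induct)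
    case inner: (less i j)
    show ?case
      unfolding optimal_def
    proof (intro allI impI)
      fix D2 assume D2: "ladder_le D D2" and ij: "(i, j) \<in> D" "(i, j) \<notin> D2"
        and agree: "D \<inter> sw i j = D2 \<inter> sw i j"
      obtain E where "\<exists>p q. ladder_move p q D E" and ED2: "ladder_le E D2"
        using D2 by (cases rule: converse_rtranclpE) (use ij in auto)
      then obtain p q u v where rect: "ladder_rect D p q u v" and E: "E = insert (u, v) (D - {(p, q)})"
        by (auto simp: ladder_move_def)
      interpret ladder_step n w D E p q u v by unfold_locales fact+
      have "(p, q) \<notin> sw i j"
        using ladder_agree(1)[OF RPD_finite[OF D] sw_closed_sw rect] ED2 agree E by blast
      then have out: "\<not> (i < p \<and> q < j)" by auto
      have EI: "E \<inter> sw i j = D2 \<inter> sw i j"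
        using ladder_agree(2)[OF RPD_finite[OF D] sw_closed_sw rect] ED2 agree E by blast
      show "\<exists>D'. move_op n i j D D' \<and> ladder_le D' D2"
      proof (cases "(p, q) = (i, j)")
        case True
        then show ?thesis using move_op_pq ED2 by auto
      next
        case ne: False
        have "D \<noteq> E" using corners(8) mem_E[of u v] by auto
        then have "row_sum UNIV E < row_sum UNIV D"
          using ladder_le_row_sum_less[OF D_le_E RPD_finite[OF D]] by simp
        then have "optimal n E i j" using outer.hyps E_RPD by blast
        moreover have "(i, j) \<in> E" using ij(1) ne by (auto simp: mem_E)
        ultimately obtain E' where mv: "move_op n i j E E'" and E'D2: "ladder_le E' D2"
          using ED2 ij(2) EI unfolding optimal_def by blast
        have ijE': "(i, j) \<notin> E'" using move_op_diagonal(2)[OF mv w E_RPD] .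
        \<comment> \<open>The recursion still has to apply the operator at \<open>(i, j)\<close> to
          the inner value \<open>D1\<close>; optimality at \<open>D1\<close> is used with target
          \<open>E'\<close> instead of \<open>D2\<close>.\<close>
        have again: "\<exists>D'. move_op n i j D1 D' \<and> ladder_le D' E'"
          if D1: "move_op n i' j' D D1" "ladder_le D1 E'"
            and i': "i' < i \<and> j' = j \<or> i' = i \<and> j < j'" for D1 i' j'
        proof -
          have "D1 \<in> RPD w" using ladder_le_RPD[OF move_op_ladder_le[OF D1(1)] D] .
          moreover have "D \<noteq> D1" using move_op_diagonal(1,2)[OF D1(1) w D] by auto
          then have "row_sum UNIV D1 < row_sum UNIV D"
            using ladder_le_row_sum_less[OF move_op_ladder_le[OF D1(1)] RPD_finite[OF D]] by simp
          ultimately have "optimal n D1 i j" using outer.hyps by blast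
          moreover have "(i, j) \<in> D1" using move_op_outside[OF D1(1) w D, of i j] i' ij(1) by auto
          moreover have "(r, c) \<in> D1 \<longleftrightarrow> (r, c) \<in> E'" if "i < r" "c < j" for r c
            using move_op_outside[OF D1(1) w D, of r c] move_op_outside[OF mv w E_RPD, of r c] i' that
              out corners(2,4)
            by (auto simp: mem_E)
          then have "D1 \<inter> sw i j = E' \<inter> sw i j" by auto
          ultimately show ?thesis using D1(2) ijE' unfolding optimal_def by blast
        qed
        have "movable E i j" using move_op_movable[OF mv] .
        then obtain h0 where h0: "1 \<le> h0" "h0 < i" "(h0, j) \<notin> E" by (auto simp: movable_def)
        \<comment> \<open>If the bump above \<open>(i, j)\<close> in \<open>E\<close> is the vacated
          tile \<open>(p, q)\<close>, then the corner \<open>(u, q)\<close> is a bump of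
          \<open>D\<close> further up.\<close>
        have "\<exists>h. 1 \<le> h \<and> h < i \<and> (h, j) \<notin> D"
        proof (cases "(h0, j) \<in> D")
          case True
          then have "h0 = p" "j = q" using h0(3) by (auto simp: mem_E)
          then show ?thesis using corners(1,2,6) h0(2) by (intro exI[of _ u]) auto
        qed (use h0 in auto)
        then have "movable D i j" using ij(1) by (auto simp: movable_def)
        then obtain h k where f: "frame n D i j h k" using frame_exists[OF w D] by blast
        have "\<exists>D'. move_op n i j D D' \<and> ladder_le D' E'"
          using f
        proof (cases rule: frame_cases)
          case (row a q0)
          show ?thesis
          proof (cases "p = i \<and> q < j \<and> j \<le> v")
            case True
            then show ?thesis using row_step_special[OF f row _ _ _ mv] by blast
          next
            case False
            have "optimal n D a j" using inner row(2) by simp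
            from row_step[OF f row ne out False mv this]
            obtain D1 where D1: "move_op n a j D D1" "ladder_le D1 E'" by blast
            obtain D' where D': "move_op n i j D1 D'" "ladder_le D' E'"
              using again[OF D1] row(2) by blast
            have "move_op n i j D D'"
              using move_op_up[OF f row(1-3) less_imp_le[OF row(4)] row(5,6)] D1(1) D'(1) by blast
            then show ?thesis using D'(2) by blast
          qed
        next
          case (col b)
          have hk: "(h, k) \<notin> D" using RPD_opposite_corner[OF D f col(1)] .
          have "n - b < n - j" using col(2,3) frameD(5)[OF f] by auto
          then have "optimal n D i b" using inner by simp
          from col_step[OF f col(1) hk col(2-5) ne out mv this] show ?thesis
          proof
            assume "\<exists>D1. move_op n i b D D1 \<and> ladder_le D1 E'"
            then obtain D1 where D1: "move_op n i b D D1" "ladder_le D1 E'" by blast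
            obtain D' where D': "move_op n i j D1 D'" "ladder_le D' E'"
              using again[OF D1] col(2) by blast
            have "move_op n i j D D'"
              using move_op_right[OF f col] D1(1) D'(1) by blast
            then show ?thesis using D'(2) by blast
          next
            assume "ladder_le (shift D h i j k) E'"
            then show ?thesis using move_op_shift[OF f col(1) hk] by blast
          qed
        next
          case full
          have l: "ladder_rect D i j h k"
            using frame_full_ladder[OF f full] RPD_opposite_corner[OF D f full(1)] by blast
          show ?thesis using full_step[OF f l ne out mv] move_op_ladder[OF f l] by blast
        qed
        then show ?thesis using E'D2 by (meson rtranclp_trans)
      qed
    qed
  qed
qed

section \<open>Several operators in a row and the criterion\<close>

lemma move_ops_ladder_le: "move_ops n xs D D' \<Longrightarrow> ladder_le D D'"
  by (induction rule: move_ops.induct) (auto intro: rtranclp_trans dest: move_op_ladder_le)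

text \<open>By incomparability the quadrant changed by one operator contains no other tile
  \<open>(i', j')\<close> of the list and therefore nothing of \<open>sw i' j'\<close>. So the
  assumptions on the remaining tiles survive each step, in whatever order the tiles are
  listed.\<close>

lemma move_ops_optimal:
  assumes "w permutes {1..n}" "D \<in> RPD w" "ladder_le D D2" "distinct xs"
    and "\<forall>(i, j) \<in> set xs. (i, j) \<in> D \<and> (i, j) \<notin> D2 \<and> D \<inter> sw i j = D2 \<inter> sw i j"
    and "\<forall>(i, j) \<in> set xs. \<forall>(i', j') \<in> set xs. i' \<le> i \<longrightarrow> j \<le> j' \<longrightarrow> (i, j) = (i', j')"
  shows "\<exists>D'. move_ops n xs D D' \<and> ladder_le D' D2"
  using assms(2-)
proof (induction xs arbitrary: D)
  case Nil
  then show ?case using move_ops.Nil by blast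
next
  case (Cons x xs)
  obtain i j where x: "x = (i, j)" by fastforce
  have ij: "(i, j) \<in> D" "(i, j) \<notin> D2" "D \<inter> sw i j = D2 \<inter> sw i j" using Cons.prems(4) x by auto
  then obtain E where E: "move_op n i j D E" "ladder_le E D2"
    using RPD_optimal[OF assms(1) Cons.prems(1), of i j] Cons.prems(2) unfolding optimal_def by blast
  have outside: "(r, c) \<in> E \<longleftrightarrow> (r, c) \<in> D" if "i < r \<or> c < j" for r c
    using move_op_outside[OF E(1) assms(1) Cons.prems(1) that] .
  have incomp: "i < i' \<or> j' < j" if "(i', j') \<in> set xs" for i' j'
  proof -
    have "(i, j) \<noteq> (i', j')" using that Cons.prems(3) x by auto
    moreover have "i' \<le> i \<longrightarrow> j \<le> j' \<longrightarrow> (i, j) = (i', j')" using that Cons.prems(5) x by auto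
    ultimately show ?thesis by linarith
  qed
  have "E \<in> RPD w" using ladder_le_RPD[OF move_op_ladder_le[OF E(1)] Cons.prems(1)] .
  moreover have "\<forall>(i', j') \<in> set xs. (i', j') \<in> E \<and> (i', j') \<notin> D2 \<and> E \<inter> sw i' j' = D2 \<inter> sw i' j'"
  proof clarify
    fix i' j' assume m: "(i', j') \<in> set xs"
    have *: "(i', j') \<in> D" "(i', j') \<notin> D2" "D \<inter> sw i' j' = D2 \<inter> sw i' j'"
      using m Cons.prems(4) by auto
    have "(r, c) \<in> E \<longleftrightarrow> (r, c) \<in> D" if "i' < r" "c < j'" for r c
      using outside[of r c] incomp[OF m] that by auto
    then have "E \<inter> sw i' j' = D \<inter> sw i' j'" by auto
    then show "(i', j') \<in> E \<and> (i', j') \<notin> D2 \<and> E \<inter> sw i' j' = D2 \<inter> sw i' j'"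
      using * outside[of i' j'] incomp[OF m] by simp
  qed
  moreover have "\<forall>(i, j) \<in> set xs. \<forall>(i', j') \<in> set xs. i' \<le> i \<longrightarrow> j \<le> j' \<longrightarrow> (i, j) = (i', j')"
    using Cons.prems(5) by auto
  ultimately obtain D' where "move_ops n xs E D'" "ladder_le D' D2"
    using Cons.IH[of E] E(2) Cons.prems(3) by auto
  then show ?case using move_ops.Cons[OF E(1)] x by blast
qed

text \<open>The list \<open>xs\<close> is an arbitrary enumeration of the finite set of extremal
  differences; this expresses that the order of the operators does not matter for the
  criterion.\<close>

theorem corollary1p2:
  fixes n :: nat and w :: "nat \<Rightarrow> nat" and D1 D2 :: "tile set" and xs :: "tile list"
  assumes "w permutes {1..n}"
    and "D1 \<in> RPD w" and "D2 \<in> RPD w"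
    and "distinct xs" and "set xs = sw_extremal_diff D1 D2"
  shows "pd_le w D1 D2 \<longleftrightarrow>
           (\<forall>(i, j) \<in> sw_extremal_diff D1 D2. (i, j) \<in> D1) \<and>
           (\<exists>D'. move_ops n xs D1 D' \<and> pd_le w D' D2)"
proof
  let ?S = "sw_extremal_diff D1 D2"
  assume "pd_le w D1 D2"
  then have le: "ladder_le D1 D2" by (simp add: pd_le_def)
  \<comment> \<open>\<open>sw_extremal_diff\<close> compares only columns from 1 on; column 0 holds
    no crosses.\<close>
  have agree: "(r, c) \<in> D1 \<longleftrightarrow> (r, c) \<in> D2"
    if "(i, j) \<in> ?S" "i \<le> r" "c \<le> j" "(r, c) \<noteq> (i, j)" for i j r c
  proof (cases "1 \<le> c")
    case True
    then show ?thesis using that by (auto simp: sw_extremal_diff_def)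
  next
    case False
    then show ?thesis using RPD_pos[OF assms(2), of r c] RPD_pos[OF assms(3), of r c] by auto
  qed
  have in_D1: "(i, j) \<in> D1 \<and> (i, j) \<notin> D2" if S: "(i, j) \<in> ?S" for i j
  proof (rule ccontr)
    assume "\<not> ((i, j) \<in> D1 \<and> (i, j) \<notin> D2)"
    then have ij: "(i, j) \<notin> D1" "(i, j) \<in> D2" "1 \<le> i" using S by (auto simp: sw_extremal_diff_def)
    \<comment> \<open>In this closed quadrant \<open>D2\<close> would have exactly one cross more
      than \<open>D1\<close>, namely \<open>(i, j)\<close>, which makes its row sum larger by
      \<open>i \<ge> 1\<close>.\<close>
    let ?I = "{i..} \<times> {..j}"
    have "D2 \<inter> ?I = insert (i, j) (D1 \<inter> ?I)" using agree[OF S] ij by auto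
    then have "row_sum ?I D2 = i + row_sum ?I D1"
      unfolding row_sum_def using ij(1) RPD_finite[OF assms(2)] by simp
    moreover have "row_sum ?I D2 \<le> row_sum ?I D1"
      using row_sum_ladder_le[OF le RPD_finite[OF assms(2)]] by (simp add: sw_closed_def)
    ultimately show False using ij(3) by simp
  qed
  have "\<forall>(i, j) \<in> ?S. (i, j) \<in> D1 \<and> (i, j) \<notin> D2 \<and> D1 \<inter> sw i j = D2 \<inter> sw i j"
  proof clarify
    fix i j assume S: "(i, j) \<in> ?S"
    have "D1 \<inter> sw i j = D2 \<inter> sw i j" using agree[OF S] by auto
    then show "(i, j) \<in> D1 \<and> (i, j) \<notin> D2 \<and> D1 \<inter> sw i j = D2 \<inter> sw i j" using in_D1[OF S] by blast
  qed
  moreover have "\<forall>(i, j) \<in> ?S. \<forall>(i', j') \<in> ?S. i' \<le> i \<longrightarrow> j \<le> j' \<longrightarrow> (i, j) = (i', j')"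
  proof (intro ballI, clarify)
    fix i j i' j' assume S: "(i, j) \<in> ?S" "(i', j') \<in> ?S" and le: "i' \<le> i" "j \<le> j'"
    then show "i = i' \<and> j = j'" using agree[OF S(2) le] in_D1[OF S(1)] by blast
  qed
  ultimately obtain D' where D': "move_ops n xs D1 D'" "ladder_le D' D2"
    using move_ops_optimal[OF assms(1,2) le assms(4)] unfolding assms(5) by blast
  have "D' \<in> RPD w" using ladder_le_RPD[OF move_ops_ladder_le[OF D'(1)] assms(2)] .
  then show "(\<forall>(i, j) \<in> ?S. (i, j) \<in> D1) \<and> (\<exists>D'. move_ops n xs D1 D' \<and> pd_le w D' D2)"
    using in_D1 D' assms(3) unfolding pd_le_def by blast
next
  assume "(\<forall>(i, j) \<in> sw_extremal_diff D1 D2. (i, j) \<in> D1) \<and> (\<exists>D'. move_ops n xs D1 D' \<and> pd_le w D' D2)"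
  then obtain D' where D': "move_ops n xs D1 D'" "pd_le w D' D2" by blast
  have "ladder_le D1 D2"
    using move_ops_ladder_le[OF D'(1)] D'(2) unfolding pd_le_def by (meson rtranclp_trans)
  then show "pd_le w D1 D2" using assms(2,3) unfolding pd_le_def by blast
qed

end
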